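(* Every temporal clique on $n$ vertices of lifetime $L$ admits a temporal $3$-spanner of size $\mathcal{O}(nL)$. That is, there is an absolute constant $c$ such that for all positive integers $n, L$, every temporal clique on $n$ vertices all of whose time labels lie in $\{1,\dots,L\}$ admits a temporal $3$-spanner of size at most $c\,nL$. Moreover, such a spanner can be computed in time $\mathcal{O}(n^3L)$.
   Context: A temporal graph $G=(V,E,\lambda)$ consists of a finite set of vertices $V$, a set of (undirected) edges $E\subseteq\binom{V}{2}$, and a labeling $\lambda\colon E\to\mathcal{P}(\mathbb{N})$ assigning to each edge a nonempty set of positive integer time labels. It is a temporal clique if $E=\binom{V}{2}$. It has lifetime $L$ if all time labels belong to $\{1,\dots,L\}$. For $u,v\in V$, a temporal $u$-$v$-path is a $u$-$v$-path in $(V,E)$ whose sequence of traversed edges $e_1,\dots,e_k$ (in order from $u$ to $v$) admits labels $\lambda_i\in\lambda(e_i)$ with $\lambda_1\le\dots\le\lambda_k$; its length (number of hops) is $k$. The size of a temporal graph $(V,E,\lambda)$ is $\sum_{e\in E}|\lambda(e)|$. A temporal $\alpha$-spanner of a temporal graph $G=(V,E,\lambda)$ is a temporal graph $G'=(V,E',\lambda')$ with $E'\subseteq E$ and $\lambda'(e)\subseteq\lambda(e)$ for every $e\in E'$ that approximates the minimum-hop temporal distance between every ordered pair of vertices within a factor $\alpha$. For a temporal clique this means: for every ordered pair of distinct vertices $u,v$, $G'$ contains a temporal $u$-$v$-path with at most $\alpha$ edges. *)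

theory Defs
  imports Main "HOL-Library.Extended_Nat"
begin

section \<open>Temporal graphs and spanners\<close>

record 'a tgraph =
  verts :: "'a set"
  edges :: "'a set set"
  labels :: "'a set \<Rightarrow> nat set"

definition all_pairs :: "'a set \<Rightarrow> 'a set set" where
  "all_pairs V = {e. e \<subseteq> V \<and> card e = 2}"

text \<open>The values of \<^const>\<open>labels\<close> outside the edge set are irrelevant throughout.\<close>

definition temporal_graph :: "'a tgraph \<Rightarrow> bool" where
  "temporal_graph G \<longleftrightarrow>
     finite (verts G) \<and> edges G \<subseteq> all_pairs (verts G) \<and>
     (\<forall>e\<in>edges G. labels G e \<noteq> {} \<and> (\<forall>t\<in>labels G e. 0 < t))"

definition temporal_clique :: "'a tgraph \<Rightarrow> bool" where
  "temporal_clique G \<longleftrightarrow> temporal_graph G \<and> edges G = all_pairs (verts G)"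

definition has_lifetime :: "'a tgraph \<Rightarrow> nat \<Rightarrow> bool" where
  "has_lifetime G L \<longleftrightarrow> (\<forall>e\<in>edges G. labels G e \<subseteq> {1..L})"

definition tg_size :: "'a tgraph \<Rightarrow> nat" where
  "tg_size G = (\<Sum>e\<in>edges G. card (labels G e))"

text \<open>A path is given by its list of vertices; the list \<open>ts\<close> holds the labels used by
  its successive edges.\<close>

definition temporal_path :: "'a tgraph \<Rightarrow> 'a \<Rightarrow> 'a list \<Rightarrow> 'a \<Rightarrow> bool" where
  "temporal_path G u p v \<longleftrightarrow>
     p \<noteq> [] \<and> hd p = u \<and> last p = v \<and> distinct p \<and> set p \<subseteq> verts G \<and>
     (\<exists>ts. Suc (length ts) = length p \<and> sorted ts \<and>
        (\<forall>i<length ts. {p ! i, p ! Suc i} \<in> edges G \<and> ts ! i \<in> labels G {p ! i, p ! Suc i}))"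

definition hops :: "'a list \<Rightarrow> nat" where
  "hops p = length p - 1"

text \<open>The distance is \<open>\<infinity>\<close> if there is no temporal path.\<close>

definition tdist :: "'a tgraph \<Rightarrow> 'a \<Rightarrow> 'a \<Rightarrow> enat" where
  "tdist G u v = (INF p \<in> {p. temporal_path G u p v}. enat (hops p))"

definition temporal_spanner :: "nat \<Rightarrow> 'a tgraph \<Rightarrow> 'a tgraph \<Rightarrow> bool" where
  "temporal_spanner \<alpha> G H \<longleftrightarrow>
     temporal_graph H \<and> verts H = verts G \<and> edges H \<subseteq> edges G \<and>
     (\<forall>e\<in>edges H. labels H e \<subseteq> labels G e) \<and>
     (\<forall>u\<in>verts G. \<forall>v\<in>verts G. tdist H u v \<le> enat \<alpha> * tdist G u v)"

lemma tdist_le_iff: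
  "tdist G u v \<le> enat k \<longleftrightarrow> (\<exists>p. temporal_path G u p v \<and> hops p \<le> k)"
proof
  assume le: "tdist G u v \<le> enat k"
  let ?S = "(\<lambda>p. enat (hops p)) ` {p. temporal_path G u p v}"
  have "?S \<noteq> {}"
  proof
    assume "?S = {}"
    then have "tdist G u v = \<infinity>"
      by (simp add: tdist_def Inf_enat_def)
    with le show False by simp
  qed
  then obtain d where "d \<in> ?S" by blast
  then have "Inf ?S \<in> ?S"
    by (rule wellorder_InfI)
  then show "\<exists>p. temporal_path G u p v \<and> hops p \<le> k"
    using le by (auto simp: tdist_def)
next
  assume "\<exists>p. temporal_path G u p v \<and> hops p \<le> k"
  then show "tdist G u v \<le> enat k"
    by (auto simp: tdist_def intro: INF_lower2)
qed

lemma tdist_refl: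
  assumes "u \<in> verts G"
  shows "tdist G u u = 0"
proof -
  from assms have "temporal_path G u [u] u"
    by (simp add: temporal_path_def)
  moreover have "hops [u] \<le> 0"
    by (simp add: hops_def)
  ultimately have "tdist G u u \<le> enat 0"
    unfolding tdist_le_iff by blast
  then show ?thesis by (simp add: zero_enat_def[symmetric])
qed

lemma tdist_clique:
  assumes "temporal_clique G" "u \<in> verts G" "v \<in> verts G" "u \<noteq> v"
  shows "tdist G u v = 1"
proof (rule antisym)
  have e: "{u, v} \<in> edges G"
    using assms by (auto simp: temporal_clique_def all_pairs_def)
  then obtain t where "t \<in> labels G {u, v}"
    using assms by (fastforce simp: temporal_clique_def temporal_graph_def)
  then have "temporal_path G u [u, v] v"
    using assms e unfolding temporal_path_def by (auto intro!: exI[of _ "[t]"])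
  then show "tdist G u v \<le> 1"
    unfolding one_enat_def tdist_le_iff by (intro exI[of _ "[u, v]"]) (simp add: hops_def)
next
  have "\<not> tdist G u v \<le> enat 0"
  proof
    assume "tdist G u v \<le> enat 0"
    then obtain p where p: "temporal_path G u p v" "hops p \<le> 0"
      unfolding tdist_le_iff by blast
    then obtain x where "p = [x]"
      by (cases p) (simp_all add: temporal_path_def hops_def)
    with p(1) assms(4) show False by (auto simp: temporal_path_def)
  qed
  then show "1 \<le> tdist G u v"
    by (simp add: zero_enat_def[symmetric] one_eSuc ileI1)
qed

lemma temporal_spanner_clique_iff:
  assumes "temporal_clique G"
  shows "temporal_spanner \<alpha> G H \<longleftrightarrow>
     temporal_graph H \<and> verts H = verts G \<and> edges H \<subseteq> edges G \<and>
     (\<forall>e\<in>edges H. labels H e \<subseteq> labels G e) \<and>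
     (\<forall>u\<in>verts G. \<forall>v\<in>verts G. u \<noteq> v \<longrightarrow> (\<exists>p. temporal_path H u p v \<and> hops p \<le> \<alpha>))"
proof -
  have *: "tdist H u v \<le> enat \<alpha> * tdist G u v \<longleftrightarrow>
      (u \<noteq> v \<longrightarrow> (\<exists>p. temporal_path H u p v \<and> hops p \<le> \<alpha>))"
    if "u \<in> verts G" "v \<in> verts G" "verts H = verts G" for u v
  proof (cases "u = v")
    case True
    then show ?thesis using that tdist_refl[of u H] by simp
  next
    case False
    then have "tdist G u v = 1" using that tdist_clique[OF assms, of u v] by simp
    then show ?thesis using False tdist_le_iff[of H u v \<alpha>] by simp
  qed
  then show ?thesis
    unfolding temporal_spanner_def by (intro conj_cong ball_cong refl *)
qed


section \<open>A machine model\<close>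

text \<open>
  Running times refer to a word RAM, programmed by structured while-programs. The memory is
  divided into named arrays, of which a program uses only finitely many; a scalar variable
  is cell \<open>0\<close> of an array. Subtraction is truncated, and nonzero values act as true, so that
  comparisons and Boolean connectives are expressible.
\<close>

type_synonym store = "string \<Rightarrow> nat \<Rightarrow> nat"

datatype exp =
    Const nat
  | Read string exp
  | Plus exp exp
  | Minus exp exp
  | Times exp exp

primrec val :: "exp \<Rightarrow> store \<Rightarrow> nat" where
  "val (Const k) s = k"
| "val (Read x e) s = s x (val e s)"
| "val (Plus e1 e2) s = val e1 s + val e2 s"
| "val (Minus e1 e2) s = val e1 s - val e2 s"
| "val (Times e1 e2) s = val e1 s * val e2 s"

datatype prog =
    Skip
  | Write string exp exp
  | Seq prog prog
  | Cond exp prog prog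
  | While exp prog

text \<open>
  \<open>exec W P s T s'\<close>: started in the store \<open>s\<close>, the program \<open>P\<close> halts in the store \<open>s'\<close> after
  \<open>T\<close> elementary steps, a step being a write or a test. Charging one unit per step is
  justified since the expressions of a fixed program have bounded size. Only values up to
  \<open>W\<close> may be stored (a run that exceeds this has no result), so for \<open>W\<close> polynomial in the
  input size each cell is a word of logarithmically many bits, which justifies unit-cost
  multiplication.
\<close>

inductive exec :: "nat \<Rightarrow> prog \<Rightarrow> store \<Rightarrow> nat \<Rightarrow> store \<Rightarrow> bool" for W :: nat where
  Skip: "exec W Skip s 1 s"
| Write: "val e s \<le> W \<Longrightarrow> val i s \<le> W \<Longrightarrow>
    exec W (Write x i e) s 1 (s(x := (s x)(val i s := val e s)))"
| Seq: "exec W P s T1 s' \<Longrightarrow> exec W Q s' T2 s'' \<Longrightarrow> exec W (Seq P Q) s (T1 + T2) s''"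
| CondTrue: "val b s \<noteq> 0 \<Longrightarrow> exec W P s T s' \<Longrightarrow> exec W (Cond b P Q) s (Suc T) s'"
| CondFalse: "val b s = 0 \<Longrightarrow> exec W Q s T s' \<Longrightarrow> exec W (Cond b P Q) s (Suc T) s'"
| WhileFalse: "val b s = 0 \<Longrightarrow> exec W (While b P) s 1 s"
| WhileTrue: "val b s \<noteq> 0 \<Longrightarrow> exec W P s T1 s' \<Longrightarrow> exec W (While b P) s' T2 s'' \<Longrightarrow>
    exec W (While b P) s (Suc (T1 + T2)) s''"

inductive_cases exec_SkipE: "exec W Skip s T s'"
  and exec_WriteE: "exec W (Write x i e) s T s'"
  and exec_SeqE: "exec W (Seq P Q) s T s'"
  and exec_CondE: "exec W (Cond b P Q) s T s'"
  and exec_WhileE: "exec W (While b P) s T s'"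

text \<open>Programs are deterministic; hence \<^const>\<open>exec\<close> determines the result and the running time.\<close>

lemma exec_deterministic:
  "exec W P s T s' \<Longrightarrow> exec W P s U s'' \<Longrightarrow> T = U \<and> s' = s''"
proof (induction arbitrary: U s'' rule: exec.induct)
  case Skip
  then show ?case by (auto elim: exec_SkipE)
next
  case (Write e s i x)
  from Write.prems show ?case by (rule exec_WriteE) simp
next
  case (Seq P s T1 s1 Q T2 s2)
  from Seq.prems obtain U1 r U2
    where "U = U1 + U2" "exec W P s U1 r" "exec W Q r U2 s''"
    by (rule exec_SeqE)
  then show ?case
    using Seq.IH(1)[of U1 r] Seq.IH(2)[of U2 s''] by simp
next
  case (CondTrue b s P T s1 Q)
  then obtain U1 where "U = Suc U1" "exec W P s U1 s''"
    by (auto elim: exec_CondE)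
  then show ?case
    using CondTrue.IH[of U1 s''] by simp
next
  case (CondFalse b s Q T s1 P)
  then obtain U1 where "U = Suc U1" "exec W Q s U1 s''"
    by (auto elim: exec_CondE)
  then show ?case
    using CondFalse.IH[of U1 s''] by simp
next
  case (WhileFalse b s P)
  from WhileFalse.prems show ?case
    by (rule exec_WhileE) (simp_all add: WhileFalse.hyps)
next
  case (WhileTrue b s P T1 s1 T2 s2)
  from WhileTrue.prems show ?case
  proof (rule exec_WhileE)
    assume "val b s = 0"
    with WhileTrue.hyps(1) show ?case by simp
  next
    fix U1 r U2
    assume "U = Suc (U1 + U2)" "exec W P s U1 r" "exec W (While b P) r U2 s''"
    then show ?case
      using WhileTrue.IH(1)[of U1 r] WhileTrue.IH(2)[of U2 s''] by simp
  qed
qed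


section \<open>Encoding of temporal graphs\<close>

text \<open>
  A temporal graph with vertex set \<open>{..<n}\<close> and lifetime \<open>L\<close> is represented by its
  three-dimensional zero-one array of labels, stored in row-major order with dimensions
  \<open>n\<close>, \<open>n\<close> and \<open>L + 1\<close> (the cells with time index \<open>0\<close> are unused). As every edge of a
  temporal graph has a label, the array determines the edges as well.
\<close>

definition label_array :: "nat \<Rightarrow> nat \<Rightarrow> nat tgraph \<Rightarrow> nat \<Rightarrow> nat" where
  "label_array n L G i =
     (if \<exists>u<n. \<exists>v<n. \<exists>t\<in>{1..L}.
           i = (u * n + v) * (L + 1) + t \<and> {u, v} \<in> edges G \<and> t \<in> labels G {u, v}
      then 1 else 0)"

definition input_store :: "nat \<Rightarrow> nat \<Rightarrow> nat tgraph \<Rightarrow> store" where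
  "input_store n L G = (\<lambda>_ _. 0)
     (''n'' := (\<lambda>_. 0)(0 := n),
      ''L'' := (\<lambda>_. 0)(0 := L),
      ''in'' := label_array n L G)"

end

theory Submission
  imports Defs
begin

text \<open>
  Give every edge a single label \<open>lab\<close> and route pairs through centres \<open>c\<close>, as \<open>u - x - c - v\<close>. For
  each \<open>u\<close> keep the edge \<open>uc\<close> and one edge \<open>ux\<close> with \<open>lab u x \<le> lab x c\<close> for which \<open>lab x c\<close>, the
  arrival time at \<open>c\<close>, is least. A pair \<open>(u, v)\<close> is missed by \<open>c\<close> only if \<open>lab c v\<close> is smaller than
  the arrival time of \<open>u\<close>. Among the pairs missed so far choose \<open>(d, w)\<close> with \<open>lab c w\<close> maximal and
  make \<open>d\<close> the next centre. For every other missed pair \<open>(u, v)\<close>, \<open>lab c v \<le> lab c w\<close> is smaller than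
  the arrival time of \<open>d\<close>, so \<open>d - v - c\<close> is not a temporal path and \<open>lab d v > lab c v\<close>. Hence the
  labels between the centre and the targets of the missed pairs grow in each round, and after
  \<open>L\<close> rounds, with at most \<open>2nL\<close> edges, nothing is missed.
\<close>

section \<open>Centres\<close>

text \<open>
  Labels vanish on the diagonal, so that \<open>x = u\<close> is admitted and stands for the direct edge \<open>uc\<close>.
\<close>

definition arrival :: "'a set \<Rightarrow> ('a \<Rightarrow> 'a \<Rightarrow> nat) \<Rightarrow> 'a \<Rightarrow> 'a \<Rightarrow> nat" where
  "arrival V lab c u = Min {lab x c | x. x \<in> V \<and> lab u x \<le> lab x c}"

text \<open>Reflexive, so that shorter routes are instances of the three-hop pattern in
  \<open>covered\<close>; symmetric, because \<open>K\<close> stores an undirected edge in whichever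
  orientation produced it.\<close>

definition adj :: "('a \<times> 'a) set \<Rightarrow> 'a \<Rightarrow> 'a \<Rightarrow> bool" where
  "adj K x y \<longleftrightarrow> x = y \<or> (x, y) \<in> K \<or> (y, x) \<in> K"

definition covered :: "'a set \<Rightarrow> ('a \<Rightarrow> 'a \<Rightarrow> nat) \<Rightarrow> ('a \<times> 'a) set \<Rightarrow> 'a \<Rightarrow> 'a \<Rightarrow> bool" where
  "covered V lab K u v \<longleftrightarrow> adj K u v \<or>
     (\<exists>x\<in>V. \<exists>c\<in>V. adj K u x \<and> adj K x c \<and> adj K c v \<and> lab u x \<le> lab x c \<and> lab x c \<le> lab c v)"

lemma covered_mono:
  assumes "covered V lab K u v" "K \<subseteq> K'"
  shows "covered V lab K' u v"
proof -
  have "adj K x y \<longrightarrow> adj K' x y" for x y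
    using assms(2) by (auto simp: adj_def)
  then show ?thesis using assms(1) unfolding covered_def by meson
qed

text \<open>The case \<open>v = c\<close> must be excluded separately: the diagonal label 0 may lie
  below the arrival time, although the kept edge \<open>uc\<close> serves this pair.\<close>

definition missed :: "'a set \<Rightarrow> ('a \<Rightarrow> 'a \<Rightarrow> nat) \<Rightarrow> 'a \<Rightarrow> 'a \<times> 'a \<Rightarrow> bool" where
  "missed V lab c = (\<lambda>(u, v). v \<noteq> c \<and> lab c v < arrival V lab c u)"

definition best_pair :: "('a \<Rightarrow> 'a \<Rightarrow> nat) \<Rightarrow> ('a \<times> 'a) set \<Rightarrow> 'a \<Rightarrow> 'a \<Rightarrow> bool" where
  "best_pair lab B c d \<longleftrightarrow> (\<exists>v. (d, v) \<in> B \<and> (\<forall>(u', v')\<in>B. lab c v' \<le> lab c v))"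

text \<open>\<open>K\<close> is the set of edges kept so far and \<open>B\<close> contains all pairs that are not yet covered.\<close>

definition step ::
  "'a set \<Rightarrow> ('a \<Rightarrow> 'a \<Rightarrow> nat) \<Rightarrow> ('a \<times> 'a) set \<Rightarrow> ('a \<times> 'a) set \<Rightarrow> 'a \<Rightarrow>
    ('a \<times> 'a) set \<Rightarrow> ('a \<times> 'a) set \<Rightarrow> 'a \<Rightarrow> bool" where
  "step V lab K B c K' B' c' \<longleftrightarrow>
     K \<subseteq> K' \<and> K' \<subseteq> V \<times> V \<and> card K' \<le> card K + 2 * card V \<and>
     (\<forall>u\<in>V. (u, c) \<in> K' \<and>
       (\<exists>x\<in>V. (u, x) \<in> K' \<and> lab u x \<le> lab x c \<and> lab x c = arrival V lab c u)) \<and>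
     B' = {p \<in> B. missed V lab c p} \<and> c' \<in> V \<and> (B' = {} \<or> best_pair lab B' c c')"

text \<open>Before the first round \<open>B\<close> contains all pairs, among them those with target
  \<open>c\<close> and diagonal label 0; the disjunct with \<open>i = 0\<close> admits exactly
  these. From the first round on, every remaining pair has a label above \<open>i\<close>.\<close>

definition rounds_inv ::
  "'a set \<Rightarrow> ('a \<Rightarrow> 'a \<Rightarrow> nat) \<Rightarrow> nat \<Rightarrow> ('a \<times> 'a) set \<Rightarrow> ('a \<times> 'a) set \<Rightarrow> 'a \<Rightarrow> bool" where
  "rounds_inv V lab i K B c \<longleftrightarrow>
     c \<in> V \<and> K \<subseteq> V \<times> V \<and> card K \<le> 2 * card V * i \<and> B \<subseteq> V \<times> V \<and>
     (\<forall>(u, v)\<in>V \<times> V - B. covered V lab K u v) \<and>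
     (\<forall>(u, v)\<in>B. (i = 0 \<and> v = c) \<or> i < lab c v)"

locale labelled_clique =
  fixes V :: "'a set" and L :: nat and lab :: "'a \<Rightarrow> 'a \<Rightarrow> nat"
  assumes finite_V: "finite V"
    and lab_sym: "lab x y = lab y x"
    and lab_refl [simp]: "lab x x = 0"
    and lab_range: "x \<in> V \<Longrightarrow> y \<in> V \<Longrightarrow> x \<noteq> y \<Longrightarrow> lab x y \<in> {1..L}"
begin

lemma arrival_le:
  assumes "x \<in> V" "lab u x \<le> lab x c"
  shows "arrival V lab c u \<le> lab x c"
  unfolding arrival_def by (rule Min_le) (use assms finite_V in auto)

lemma arrival_attained:
  assumes "u \<in> V"
  obtains x where "x \<in> V" "lab u x \<le> lab x c" "lab x c = arrival V lab c u"
proof -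
  let ?S = "{lab x c | x. x \<in> V \<and> lab u x \<le> lab x c}"
  \<comment> \<open>The choice \<open>x = u\<close> is admissible since \<open>lab u u = 0\<close>,
    so the minimum is over a nonempty set.\<close>
  have "lab u c \<in> ?S" using assms by force
  moreover have "finite ?S" using finite_V by auto
  ultimately have "Min ?S \<in> ?S" by (intro Min_in) auto
  then show ?thesis using that by (auto simp: arrival_def)
qed

lemma arrival_eqI:
  assumes "x \<in> V" "lab u x \<le> lab x c"
    and "\<And>y. y \<in> V \<Longrightarrow> lab u y \<le> lab y c \<Longrightarrow> lab x c \<le> lab y c"
  shows "arrival V lab c u = lab x c"
  unfolding arrival_def by (rule Min_eqI) (use assms finite_V in auto)

text \<open>A pair that leaves \<open>B\<close> is served by the centre \<open>c\<close>, and for a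
  pair that stays the label to the new centre is larger than the label to the old one.\<close>

lemma step_inv:
  assumes inv: "rounds_inv V lab i K B c" and st: "step V lab K B c K' B' c'"
  shows "rounds_inv V lab (Suc i) K' B' c'"
proof -
  have sub: "K \<subseteq> K'" "B' \<subseteq> B" using st by (auto simp: step_def)
  have cov: "covered V lab K' u v" if uv: "u \<in> V" "v \<in> V" "(u, v) \<notin> B'" for u v
  proof (cases "(u, v) \<in> B")
    case False
    with inv uv have "covered V lab K u v" unfolding rounds_inv_def by blast
    then show ?thesis using sub(1) by (rule covered_mono)
  next
    case True
    show ?thesis
    proof (cases "v = c")
      case True
      then show ?thesis using st uv(1) by (auto simp: step_def covered_def adj_def)
    next
      case False
      with st True uv have le: "arrival V lab c u \<le> lab c v"
        by (auto simp: step_def missed_def)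
      from st uv obtain x where x: "x \<in> V" "(u, x) \<in> K'" "lab u x \<le> lab x c"
        "lab x c = arrival V lab c u" unfolding step_def by blast
      have K': "(x, c) \<in> K'" "(v, c) \<in> K'" using st x(1) uv(2) by (auto simp: step_def)
      have c: "c \<in> V" using inv by (simp add: rounds_inv_def)
      show ?thesis
        unfolding covered_def
        by (intro disjI2 bexI[OF _ x(1)] bexI[OF _ c]) (use x K' le in \<open>auto simp: adj_def\<close>)
    qed
  qed
  \<comment> \<open>If c' - v' - c respected time, then c' would reach c by time
    \<open>lab v' c\<close>, which is at most \<open>lab c v\<close> for the missed pair (c', v)
    that made c' the next centre. This contradicts that the pair is missed, so
    \<open>lab c' v'\<close> exceeds \<open>lab c v'\<close>, which exceeds
    \<open>i\<close>.\<close>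
  have lab': "Suc i < lab c' v'" if m: "(u', v') \<in> B'" for u' v'
  proof -
    from st m obtain v where v: "(c', v) \<in> B'" "lab c v' \<le> lab c v"
      unfolding step_def best_pair_def by blast
    have v'V: "v' \<in> V" using m sub(2) inv by (auto simp: rounds_inv_def)
    have "lab c v < arrival V lab c c'" using st v(1) by (auto simp: step_def missed_def)
    with v(2) have "\<not> arrival V lab c c' \<le> lab v' c" by (simp add: lab_sym)
    with arrival_le[OF v'V] have 1: "lab v' c < lab c' v'" by (meson not_le)
    \<comment> \<open>This rules out the exceptional disjunct of \<open>rounds_inv\<close> for
      \<open>i = 0\<close>.\<close>
    have "v' \<noteq> c" using st m by (auto simp: step_def missed_def)
    with inv m sub(2) have "i < lab c v'" by (auto simp: rounds_inv_def)
    with 1 show ?thesis by (simp add: lab_sym)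
  qed
  show ?thesis
    using inv st sub(2) cov lab' unfolding rounds_inv_def step_def by auto
qed

lemma rounds_inv_init: "c \<in> V \<Longrightarrow> rounds_inv V lab 0 {} (V \<times> V) c"
  using lab_range by (fastforce simp: rounds_inv_def)

text \<open>A pair left in \<open>B\<close> would have a label above \<open>L\<close>, which does
  not exist; \<open>L \<ge> 1\<close> excludes the initial disjunct of the invariant.\<close>

lemma rounds_inv_final:
  assumes "rounds_inv V lab L K B c" "L \<ge> 1"
  shows "\<And>u v. u \<in> V \<Longrightarrow> v \<in> V \<Longrightarrow> covered V lab K u v"
proof -
  have "\<not> L < lab c v" if "(u, v) \<in> B" for u v
  proof (cases "v = c")
    case False
    then show ?thesis using lab_range[of c v] that assms(1) by (auto simp: rounds_inv_def)
  qed simp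
  then have "B = {}" using assms by (fastforce simp: rounds_inv_def)
  then show "covered V lab K u v" if "u \<in> V" "v \<in> V" for u v
    using assms(1) that by (auto simp: rounds_inv_def)
qed

text \<open>\<open>step\<close> leaves ties open, so that the program may break them in its own way;
  here an arbitrary choice function and an arbitrary maximiser are taken.\<close>

lemma step_exists:
  assumes inv: "rounds_inv V lab i K B c"
  shows "\<exists>K' B' c'. step V lab K B c K' B' c'"
proof -
  have "\<forall>u\<in>V. \<exists>x. x \<in> V \<and> lab u x \<le> lab x c \<and> lab x c = arrival V lab c u"
    by (metis arrival_attained)
  then obtain f where f: "\<And>u. u \<in> V \<Longrightarrow> f u \<in> V \<and> lab u (f u) \<le> lab (f u) c \<and>
      lab (f u) c = arrival V lab c u" by metis
  have c: "c \<in> V" and K: "K \<subseteq> V \<times> V" and B: "B \<subseteq> V \<times> V"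
    using inv by (auto simp: rounds_inv_def)
  \<comment> \<open>Two edges for each \<open>u\<close>, one to the centre and one to the neighbour
    of least arrival time, give the growth by \<open>2 * card V\<close>.\<close>
  define S where "S = (\<lambda>u. (u, c)) ` V \<union> (\<lambda>u. (u, f u)) ` V"
  have "card S \<le> card V + card V"
    unfolding S_def by (intro order_trans[OF card_Un_le] add_mono card_image_le finite_V)
  then have cK: "card (K \<union> S) \<le> card K + 2 * card V"
    using card_Un_le[of K S] by linarith
  define B' where "B' = {p \<in> B. missed V lab c p}"
  have "\<exists>c'\<in>V. B' = {} \<or> best_pair lab B' c c'"
  proof (cases "B' = {}")
    case False
    have fin: "finite B'"
      by (rule finite_subset[of _ "V \<times> V"]) (use B finite_V in \<open>auto simp: B'_def\<close>)
    let ?M = "Max ((\<lambda>(u, v). lab c v) ` B')"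
    have "?M \<in> (\<lambda>(u, v). lab c v) ` B'" using fin False by (intro Max_in) auto
    then obtain d v where dv: "(d, v) \<in> B'" "lab c v = ?M" by fastforce
    have "lab c v' \<le> lab c v" if "(u', v') \<in> B'" for u' v'
      unfolding dv(2) by (rule Max_ge) (use fin that in force)+
    then have "best_pair lab B' c d" using dv(1) unfolding best_pair_def by blast
    moreover have "d \<in> V" using dv B by (auto simp: B'_def)
    ultimately show ?thesis by blast
  qed (use c in auto)
  then obtain c' where "c' \<in> V" "B' = {} \<or> best_pair lab B' c c'" by blast
  then have "step V lab K B c (K \<union> S) B' c'"
    unfolding step_def using f c K cK
    by (intro conjI ballI) (auto simp: S_def B'_def)
  then show ?thesis by blast
qed

lemma rounds_exist:
  assumes "c \<in> V"
  shows "\<exists>K B c. rounds_inv V lab i K B c"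
proof (induction i)
  case 0
  then show ?case using rounds_inv_init[OF assms] by blast
next
  case (Suc i)
  then show ?case using step_exists step_inv by metis
qed

end


section \<open>The spanner\<close>

text \<open>A singleton is never an edge, so the default 0 makes labels vanish on the diagonal, as
  \<open>labelled_clique\<close> demands.\<close>

definition first_label :: "'a tgraph \<Rightarrow> 'a set \<Rightarrow> nat" where
  "first_label G e = (if e \<in> edges G then LEAST t. t \<in> labels G e else 0)"

definition edge_label :: "'a tgraph \<Rightarrow> 'a \<Rightarrow> 'a \<Rightarrow> nat" where
  "edge_label G u v = first_label G {u, v}"

text \<open>Loops get into \<open>K\<close> whenever \<open>u\<close> coincides with its centre or
  with its chosen neighbour; they are dropped here. With a single label per edge, the size is the
  number of edges.\<close>

definition kept_graph :: "'a tgraph \<Rightarrow> ('a \<times> 'a) set \<Rightarrow> 'a tgraph" where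
  "kept_graph G K = \<lparr>verts = verts G, edges = {{u, v} | u v. (u, v) \<in> K \<and> u \<noteq> v},
     labels = (\<lambda>e. {first_label G e})\<rparr>"

lemma first_label_in:
  assumes "temporal_graph G" "e \<in> edges G"
  shows "first_label G e \<in> labels G e"
proof -
  obtain t where "t \<in> labels G e" using assms by (fastforce simp: temporal_graph_def)
  then show ?thesis using assms(2) by (auto simp: first_label_def intro: LeastI)
qed

lemma pair_edge_iff:
  assumes "temporal_clique G" "u \<in> verts G" "v \<in> verts G"
  shows "{u, v} \<in> edges G \<longleftrightarrow> u \<noteq> v"
  using assms by (auto simp: temporal_clique_def all_pairs_def)

lemma labelled_clique_edge_label:
  assumes "temporal_clique G" "has_lifetime G L"
  shows "labelled_clique (verts G) L (edge_label G)"
proof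
  have tg: "temporal_graph G" using assms by (simp add: temporal_clique_def)
  show "finite (verts G)" using tg by (simp add: temporal_graph_def)
  show "edge_label G x y = edge_label G y x" for x y
    by (simp add: edge_label_def insert_commute)
  show "edge_label G x x = 0" for x
    using tg by (auto simp: edge_label_def first_label_def temporal_graph_def all_pairs_def)
  show "edge_label G x y \<in> {1..L}" if "x \<in> verts G" "y \<in> verts G" "x \<noteq> y" for x y
  proof -
    have "{x, y} \<in> edges G" using pair_edge_iff[OF assms(1)] that by blast
    with first_label_in[OF tg this] assms(2) show ?thesis
      unfolding edge_label_def has_lifetime_def by blast
  qed
qed

lemma kept_graph_edge:
  "{u, v} \<in> edges (kept_graph G K) \<longleftrightarrow> u \<noteq> v \<and> adj K u v"
proof
  assume "{u, v} \<in> edges (kept_graph G K)"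
  then obtain a b where ab: "{u, v} = {a, b}" "(a, b) \<in> K" "a \<noteq> b"
    unfolding kept_graph_def by auto
  from ab(1) have "u = a \<and> v = b \<or> u = b \<and> v = a" by (simp only: doubleton_eq_iff)
  with ab show "u \<noteq> v \<and> adj K u v" by (auto simp: adj_def)
next
  assume "u \<noteq> v \<and> adj K u v"
  then obtain a b where "{u, v} = {a, b}" "(a, b) \<in> K" "a \<noteq> b"
    using insert_commute[of u v "{}"] unfolding adj_def by fast
  then show "{u, v} \<in> edges (kept_graph G K)"
    unfolding kept_graph_def tgraph.simps by blast
qed

text \<open>The route u - x - c - v may repeat vertices, whereas a path may not. Removing the
  repetitions leaves one, two or three hops, and the labels used remain nondecreasing.\<close>

lemma covered_path:
  assumes cov: "covered (verts G) (edge_label G) K u v"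
    and uv: "u \<in> verts G" "v \<in> verts G" "u \<noteq> v"
  shows "\<exists>p. temporal_path (kept_graph G K) u p v \<and> hops p \<le> 3"
proof -
  let ?H = "kept_graph G K" and ?l = "edge_label G"
  have V: "verts ?H = verts G" and lab: "\<And>a b. ?l a b \<in> labels ?H {a, b}"
    by (simp_all add: kept_graph_def edge_label_def)
  have one: ?thesis if "adj K u v"
    by (rule exI[of _ "[u, v]"])
      (use that uv V lab in \<open>auto simp: temporal_path_def hops_def kept_graph_edge
        intro!: exI[of _ "[?l u v]"]\<close>)
  have two: ?thesis if "adj K u x" "adj K x v" "x \<noteq> u" "x \<noteq> v" "x \<in> verts G" "?l u x \<le> ?l x v" for x
    by (rule exI[of _ "[u, x, v]"])
      (use that uv V lab in \<open>auto simp: temporal_path_def hops_def kept_graph_edge nth_Cons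
        split: nat.split intro!: exI[of _ "[?l u x, ?l x v]"]\<close>)
  have three: ?thesis if "adj K u x" "adj K x c" "adj K c v" "distinct [u, x, c, v]"
    "x \<in> verts G" "c \<in> verts G" "?l u x \<le> ?l x c" "?l x c \<le> ?l c v" for x c
    by (rule exI[of _ "[u, x, c, v]"])
      (use that uv V lab in \<open>auto simp: temporal_path_def hops_def kept_graph_edge nth_Cons
        split: nat.split intro!: exI[of _ "[?l u x, ?l x c, ?l c v]"]\<close>)
  show ?thesis
  proof (cases "adj K u v")
    case False
    with cov obtain x c where x: "x \<in> verts G" and c: "c \<in> verts G"
      and a: "adj K u x" "adj K x c" "adj K c v" and l: "?l u x \<le> ?l x c" "?l x c \<le> ?l c v"
      unfolding covered_def by blast
    \<comment> \<open>Each of these coincidences would make \<open>u\<close> and \<open>v\<close>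
      adjacent.\<close>
    from a False have "x \<noteq> v" "c \<noteq> u" "\<not> (u = x \<and> c = v)" by auto
    then consider "distinct [u, x, c, v]" | "u = x" "c \<noteq> v" "c \<noteq> u"
      | "c = v" "x \<noteq> u" "x \<noteq> v" | "x = c" "x \<noteq> u" "x \<noteq> v"
      using uv(3) by auto
    then show ?thesis
    proof cases
      case 1
      with three[of x c] a x c l show ?thesis by simp
    next
      case 2
      with two[of c] a c l show ?thesis by simp
    next
      case 3
      with two[of x] a x l show ?thesis by simp
    next
      case 4
      with two[of x] a x l show ?thesis by simp
    qed
  qed (rule one)
qed

lemma kept_graph_spanner:
  assumes G: "temporal_clique G" and K: "K \<subseteq> verts G \<times> verts G"
    and cov: "\<And>u v. u \<in> verts G \<Longrightarrow> v \<in> verts G \<Longrightarrow> covered (verts G) (edge_label G) K u v"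
  shows "temporal_spanner 3 G (kept_graph G K)"
proof -
  let ?H = "kept_graph G K"
  have tg: "temporal_graph G" using G by (simp add: temporal_clique_def)
  have sub: "edges ?H \<subseteq> edges G"
  proof
    fix e assume "e \<in> edges ?H"
    then obtain u v where "e = {u, v}" "(u, v) \<in> K" "u \<noteq> v"
      unfolding kept_graph_def by auto
    with K pair_edge_iff[OF G, of u v] show "e \<in> edges G" by blast
  qed
  have lb: "labels ?H e \<subseteq> labels G e" if "e \<in> edges ?H" for e
    using first_label_in[OF tg] that sub by (auto simp: kept_graph_def)
  have V: "verts ?H = verts G" by (simp add: kept_graph_def)
  have "labels ?H e \<noteq> {}" for e by (simp add: kept_graph_def)
  moreover have "0 < t" if "e \<in> edges ?H" "t \<in> labels ?H e" for e t
    using tg sub lb[OF that(1)] that unfolding temporal_graph_def by blast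
  moreover have "finite (verts G)" "edges ?H \<subseteq> all_pairs (verts G)"
    using tg sub unfolding temporal_graph_def by blast+
  ultimately have "temporal_graph ?H"
    unfolding temporal_graph_def V by blast
  then show ?thesis
    unfolding temporal_spanner_clique_iff[OF G]
    using sub lb V covered_path[OF cov] by blast
qed

lemma tg_size_kept_graph:
  assumes "finite K"
  shows "tg_size (kept_graph G K) \<le> card K"
proof -
  have "edges (kept_graph G K) \<subseteq> (\<lambda>(u, v). {u, v}) ` K"
    by (auto simp: kept_graph_def)
  then have "card (edges (kept_graph G K)) \<le> card K"
    by (meson assms card_image_le card_mono finite_imageI le_trans)
  then show ?thesis by (simp add: tg_size_def kept_graph_def)
qed

text \<open>Stated for any result of \<open>L\<close> rounds, so that it serves both the abstract
  construction and the program.\<close>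

lemma rounds_spanner:
  assumes G: "temporal_clique G" "has_lifetime G L" and L: "L \<ge> 1"
    and inv: "rounds_inv (verts G) (edge_label G) L K B c"
  shows "temporal_spanner 3 G (kept_graph G K)"
    and "tg_size (kept_graph G K) \<le> 2 * card (verts G) * L"
proof -
  interpret labelled_clique "verts G" L "edge_label G"
    using G by (rule labelled_clique_edge_label)
  have K: "K \<subseteq> verts G \<times> verts G" "card K \<le> 2 * card (verts G) * L"
    using inv by (simp_all add: rounds_inv_def)
  show "temporal_spanner 3 G (kept_graph G K)"
    using G(1) K(1) rounds_inv_final[OF inv L] by (rule kept_graph_spanner)
  have "finite K" using K(1) finite_V by (meson finite_SigmaI finite_subset)
  then show "tg_size (kept_graph G K) \<le> 2 * card (verts G) * L"
    using tg_size_kept_graph[of K G] K(2) by linarith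
qed

lemma small_spanner_exists:
  assumes G: "temporal_clique G" "has_lifetime G L" and "card (verts G) \<ge> 1" "L \<ge> 1"
  shows "\<exists>H. temporal_spanner 3 G H \<and> tg_size H \<le> 2 * card (verts G) * L"
proof -
  interpret labelled_clique "verts G" L "edge_label G"
    using G by (rule labelled_clique_edge_label)
  obtain c where "c \<in> verts G" using assms(3) by fastforce
  then show ?thesis using rounds_exist rounds_spanner[OF G assms(4)] by metis
qed


section \<open>Program logic\<close>

text \<open>Total correctness with a time bound: the run exists, so it halts and never stores a
  value above \<open>W\<close>.\<close>

definition runs :: "nat \<Rightarrow> prog \<Rightarrow> store \<Rightarrow> nat \<Rightarrow> (store \<Rightarrow> bool) \<Rightarrow> bool" where
  "runs W P s b Q \<longleftrightarrow> (\<exists>T s'. exec W P s T s' \<and> T \<le> b \<and> Q s')"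

abbreviation Var :: "string \<Rightarrow> exp" where
  "Var x \<equiv> Read x (Const 0)"

definition assign :: "string \<Rightarrow> nat \<Rightarrow> store \<Rightarrow> store" where
  "assign x k s = s(x := (s x)(0 := k))"

text \<open>Subtraction is truncated, so the guard is nonzero exactly while the counter is below
  \<open>e\<close>. The bound is evaluated anew at every test, hence the assumption
  \<open>bound\<close> in \<open>runs_For\<close>.\<close>

definition For :: "string \<Rightarrow> exp \<Rightarrow> prog \<Rightarrow> prog" where
  "For i e P = Seq (Write i (Const 0) (Const 0))
     (While (Minus e (Var i)) (Seq P (Write i (Const 0) (Plus (Var i) (Const 1)))))"

lemma assign_apply [simp]:
  "assign x k s y = (if y = x then (s x)(0 := k) else s y)"
  by (simp add: assign_def)

lemma runsI: "exec W P s T s' \<Longrightarrow> T \<le> b \<Longrightarrow> Q s' \<Longrightarrow> runs W P s b Q"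
  by (auto simp: runs_def)

lemma runs_weaken:
  "runs W P s b Q \<Longrightarrow> b \<le> b' \<Longrightarrow> (\<And>s'. Q s' \<Longrightarrow> Q' s') \<Longrightarrow> runs W P s b' Q'"
  unfolding runs_def by (meson le_trans)

lemma runs_Skip: "1 \<le> b \<Longrightarrow> Q s \<Longrightarrow> runs W Skip s b Q"
  unfolding runs_def using exec.Skip by blast

lemma runs_Write:
  assumes "val e s \<le> W" "val i s \<le> W" "1 \<le> b" "Q (s(x := (s x)(val i s := val e s)))"
  shows "runs W (Write x i e) s b Q"
  unfolding runs_def using exec.Write[OF assms(1,2)] assms(3,4) by blast

lemma runs_assign:
  assumes "val e s \<le> W" "1 \<le> b" "Q (assign x (val e s) s)"
  shows "runs W (Write x (Const 0) e) s b Q"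
  using assms by (intro runs_Write) (simp_all add: assign_def)

lemma runs_Seq:
  assumes "runs W P s a R" "\<And>s'. R s' \<Longrightarrow> runs W P' s' a' Q" "a + a' \<le> b"
  shows "runs W (Seq P P') s b Q"
proof -
  obtain T s' where 1: "exec W P s T s'" "T \<le> a" "R s'"
    using assms(1) by (auto simp: runs_def)
  obtain T' s'' where 2: "exec W P' s' T' s''" "T' \<le> a'" "Q s''"
    using assms(2)[OF 1(3)] by (auto simp: runs_def)
  show ?thesis
    using exec.Seq[OF 1(1) 2(1)] by (rule runsI) (use 1(2) 2(2,3) assms(3) in auto)
qed

lemma runs_Cond:
  assumes "val e s \<noteq> 0 \<Longrightarrow> runs W P s b Q" "val e s = 0 \<Longrightarrow> runs W P' s b Q" "Suc b \<le> b'"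
  shows "runs W (Cond e P P') s b' Q"
proof (cases "val e s = 0")
  case True
  then obtain T s' where T: "exec W P' s T s'" "T \<le> b" "Q s'"
    using assms(2) by (auto simp: runs_def)
  show ?thesis
    by (rule runsI[OF exec.CondFalse[OF True T(1)]]) (use T assms(3) in auto)
next
  case False
  then obtain T s' where T: "exec W P s T s'" "T \<le> b" "Q s'"
    using assms(1) by (auto simp: runs_def)
  show ?thesis
    by (rule runsI[OF exec.CondTrue[OF False T(1)]]) (use T assms(3) in auto)
qed

text \<open>Each iteration costs the body plus one test and one increment; the remaining 2 steps are
  the initialisation and the final test. The counter reaches \<open>N\<close>, so \<open>N\<close>
  has to fit into a word.\<close>

lemma runs_For:
  assumes init: "I 0 (assign i 0 s)"
    and body: "\<And>k s. k < N \<Longrightarrow> s i 0 = k \<Longrightarrow> I k s \<Longrightarrow>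
        runs W P s b (\<lambda>s'. s' i 0 = k \<and> I (Suc k) (assign i (Suc k) s'))"
    and bound: "\<And>k s. I k s \<Longrightarrow> val e s = N"
    and final: "\<And>s. I N s \<Longrightarrow> Q s"
    and "N \<le> W" "2 + N * (b + 2) \<le> B"
  shows "runs W (For i e P) s B Q"
proof -
  let ?P = "Seq P (Write i (Const 0) (Plus (Var i) (Const 1)))"
  \<comment> \<open>Here \<open>m\<close> counts the iterations still to come, and the induction is
    on it.\<close>
  have loop: "runs W (While (Minus e (Var i)) ?P) s (1 + m * (b + 2)) Q"
    if "k + m = N" "s i 0 = k" "I k s" for k m s
    using that
  proof (induction m arbitrary: k s)
    case 0
    then show ?case
      using exec.WhileFalse[of "Minus e (Var i)" s W ?P] bound final by (auto intro!: runsI)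
  next
    case (Suc m)
    have "runs W ?P s (b + 1) (\<lambda>s'. s' i 0 = Suc k \<and> I (Suc k) s')"
      by (rule runs_Seq[OF body[of k]]) (use Suc.prems \<open>N \<le> W\<close> in \<open>auto intro!: runs_assign\<close>)
    then obtain T1 s1 where 1: "exec W ?P s T1 s1" "T1 \<le> b + 1" "s1 i 0 = Suc k" "I (Suc k) s1"
      by (auto simp: runs_def)
    from Suc.IH[of "Suc k" s1] Suc.prems 1 obtain T2 s2 where
      2: "exec W (While (Minus e (Var i)) ?P) s1 T2 s2" "T2 \<le> 1 + m * (b + 2)" "Q s2"
      by (auto simp: runs_def)
    have "val (Minus e (Var i)) s \<noteq> 0" using Suc.prems bound[of k s] by simp
    from exec.WhileTrue[OF this 1(1) 2(1)] show ?case
      by (rule runsI) (use 1(2) 2(2,3) in auto)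
  qed
  show ?thesis
    unfolding For_def
    by (rule runs_Seq[where R = "\<lambda>s. s i 0 = 0 \<and> I 0 s" and a = 1 and a' = "1 + N * (b + 2)"])
      (use init loop[of 0 N] assms(6) in \<open>auto intro!: runs_assign\<close>)
qed


section \<open>The algorithm\<close>

definition LE :: "exp \<Rightarrow> exp \<Rightarrow> exp" where
  "LE e1 e2 = Minus (Const 1) (Minus e1 e2)"

definition LT :: "exp \<Rightarrow> exp \<Rightarrow> exp" where
  "LT e1 e2 = Minus e2 e1"

definition NE :: "exp \<Rightarrow> exp \<Rightarrow> exp" where
  "NE e1 e2 = Plus (Minus e1 e2) (Minus e2 e1)"

text \<open>Comparisons become tests for nonzero values. In the programs below \<open>Times\<close>
  then acts as conjunction and \<open>Plus\<close> as disjunction.\<close>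

lemma val_compare [simp]:
  "0 < val (LE e1 e2) s \<longleftrightarrow> val e1 s \<le> val e2 s" "val (LE e1 e2) s = 0 \<longleftrightarrow> val e2 s < val e1 s"
  "0 < val (LT e1 e2) s \<longleftrightarrow> val e1 s < val e2 s" "val (LT e1 e2) s = 0 \<longleftrightarrow> val e2 s \<le> val e1 s"
  "0 < val (NE e1 e2) s \<longleftrightarrow> val e1 s \<noteq> val e2 s" "val (NE e1 e2) s = 0 \<longleftrightarrow> val e1 s = val e2 s"
  by (auto simp: LE_def LT_def NE_def)

definition index2 :: "string \<Rightarrow> string \<Rightarrow> exp" where
  "index2 u v = Plus (Times (Var u) (Var ''n'')) (Var v)"

text \<open>The address formula of \<open>label_array\<close>, with \<open>L + 1\<close> slots for
  each pair.\<close>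

definition cell :: "nat \<Rightarrow> nat \<Rightarrow> nat \<Rightarrow> nat \<Rightarrow> nat \<Rightarrow> nat" where
  "cell n L u v t = (u * n + v) * (L + 1) + t"

definition index3 :: "string \<Rightarrow> string \<Rightarrow> exp \<Rightarrow> exp" where
  "index3 u v e = Plus (Times (index2 u v) (Plus (Var ''L'') (Const 1))) e"

lemma val_index [simp]:
  "val (index2 u v) s = s u 0 * s ''n'' 0 + s v 0"
  "val (index3 u v e) s = cell (s ''n'' 0) (s ''L'' 0) (s u 0) (s v 0) (val e s)"
  by (simp_all add: index2_def index3_def cell_def)

text \<open>
  \<open>m\<close> holds the edge labels, \<open>h\<close> marks the kept edges and \<open>g\<close> the covered pairs, all as
  \<open>n\<close> by \<open>n\<close> arrays. \<open>c\<close> is the centre, \<open>x\<close> the best neighbour for the row \<open>u\<close>, and \<open>d\<close>, \<open>b\<close> are the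
  source of the best missed pair found so far and the label from \<open>c\<close> to its target. In
  \<open>find_labels\<close> the labels are tried in decreasing order, so the least one is written last.
\<close>

definition find_labels :: prog where
  "find_labels =
     For ''u'' (Var ''n'') (For ''v'' (Var ''n'')
       (Seq (Write ''m'' (index2 ''u'' ''v'') (Const 0)) (For ''t'' (Var ''L'')
       (Cond (Read ''in'' (index3 ''u'' ''v'' (Minus (Var ''L'') (Var ''t''))))
         (Write ''m'' (index2 ''u'' ''v'') (Minus (Var ''L'') (Var ''t''))) Skip))))"

definition find_arrival :: prog where
  "find_arrival =
     For ''y'' (Var ''n'')
       (Cond (Times (LE (Read ''m'' (index2 ''u'' ''y'')) (Read ''m'' (index2 ''y'' ''c'')))
           (LT (Read ''m'' (index2 ''y'' ''c'')) (Read ''m'' (index2 ''x'' ''c''))))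
         (Write ''x'' (Const 0) (Var ''y'')) Skip)"

definition scan_row :: prog where
  "scan_row =
     For ''v'' (Var ''n'')
       (Cond (Times (LT (Read ''g'' (index2 ''u'' ''v'')) (Const 1))
           (Times (NE (Var ''v'') (Var ''c''))
             (LT (Read ''m'' (index2 ''c'' ''v'')) (Read ''m'' (index2 ''x'' ''c'')))))
         (Cond (LE (Var ''b'') (Read ''m'' (index2 ''c'' ''v'')))
           (Seq (Write ''b'' (Const 0) (Read ''m'' (index2 ''c'' ''v'')))
             (Write ''d'' (Const 0) (Var ''u'')))
           Skip)
         (Write ''g'' (index2 ''u'' ''v'') (Const 1)))"

text \<open>The next centre is collected in \<open>d\<close>, since \<open>c\<close> has to stay
  fixed during the round. Starting \<open>d\<close> at \<open>c\<close> ensures that the new centre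
  is a vertex even if no pair is missed.\<close>

definition round_prog :: prog where
  "round_prog =
     Seq (Write ''b'' (Const 0) (Const 0))
    (Seq (Write ''d'' (Const 0) (Var ''c''))
    (Seq (For ''u'' (Var ''n'')
           (Seq (Write ''x'' (Const 0) (Var ''u''))
           (Seq find_arrival
           (Seq (Write ''h'' (index2 ''u'' ''c'') (Const 1))
           (Seq (Write ''h'' (index2 ''u'' ''x'') (Const 1))
             scan_row)))))
      (Write ''c'' (Const 0) (Var ''d''))))"

text \<open>The factor \<open>m\<close> excludes the diagonal, and both orientations in
  \<open>h\<close> are tested because kept edges are stored in only one of them.\<close>

definition output_prog :: prog where
  "output_prog =
     For ''u'' (Var ''n'') (For ''v'' (Var ''n'')
       (Cond (Times (Read ''m'' (index2 ''u'' ''v''))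
           (Plus (Read ''h'' (index2 ''u'' ''v'')) (Read ''h'' (index2 ''v'' ''u''))))
         (Write ''out'' (index3 ''u'' ''v'' (Read ''m'' (index2 ''u'' ''v''))) (Const 1)) Skip))"

definition spanner_prog :: prog where
  "spanner_prog = Seq find_labels (Seq (For ''i'' (Var ''L'') round_prog) output_prog)"

section \<open>Sets and matrices in row-major order\<close>

definition pairs :: "nat \<Rightarrow> (nat \<Rightarrow> nat) \<Rightarrow> (nat \<times> nat) set" where
  "pairs n f = {(u, v). u < n \<and> v < n \<and> f (u * n + v) \<noteq> 0}"

definition matrix :: "nat \<Rightarrow> (nat \<Rightarrow> nat) \<Rightarrow> (nat \<Rightarrow> nat \<Rightarrow> nat) \<Rightarrow> bool" where
  "matrix n f A \<longleftrightarrow> (\<forall>u<n. \<forall>v<n. f (u * n + v) = A u v)"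

text \<open>An initial segment of the lexicographic order: what a nested loop has handled when it
  arrives at \<open>(k, j)\<close>.\<close>

definition before :: "nat \<Rightarrow> nat \<Rightarrow> nat \<Rightarrow> (nat \<times> nat) set" where
  "before n k j = {(u, v). u < n \<and> v < n \<and> (u < k \<or> u = k \<and> v < j)}"

text \<open>Division by \<open>n\<close> recovers the row, because the column is smaller than
  \<open>n\<close>.\<close>

lemma row_major_inj:
  assumes "v < n" "v' < (n::nat)"
  shows "u * n + v = u' * n + v' \<longleftrightarrow> u = u' \<and> v = v'"
proof
  assume eq: "u * n + v = u' * n + v'"
  have "(u * n + v) div n = u" "(u' * n + v') div n = u'" using assms by auto
  with eq have "u = u'" by metis
  with eq show "u = u' \<and> v = v'" by simp
qed simp

lemma pairs_update:
  "u < n \<Longrightarrow> v < n \<Longrightarrow> pairs n (f(u * n + v := Suc 0)) = insert (u, v) (pairs n f)"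
  by (auto simp: pairs_def row_major_inj)

lemma matrixD: "matrix n f A \<Longrightarrow> u < n \<Longrightarrow> v < n \<Longrightarrow> f (u * n + v) = A u v"
  by (simp add: matrix_def)

lemma before_start [simp]: "before n 0 0 = {}"
  by (auto simp: before_def)

lemma before_row: "before n k n = before n (Suc k) 0"
  by (auto simp: before_def)

lemma before_Suc: "k < n \<Longrightarrow> j < n \<Longrightarrow> before n k (Suc j) = insert (k, j) (before n k j)"
  by (auto simp: before_def)

lemma before_all: "before n n 0 = {..<n} \<times> {..<n}"
  by (auto simp: before_def)

lemma index2_bound: "u < n \<Longrightarrow> v < n \<Longrightarrow> u * n + v < n * (n::nat)"
proof -
  assume "u < n" "v < n"
  then have "u * n + v < Suc u * n" "Suc u * n \<le> n * n"
    by (simp, intro mult_le_mono1) simp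
  then show ?thesis by (rule less_le_trans)
qed

text \<open>Addresses of writes are subject to the word bound in \<open>exec\<close>, so they must
  be estimated like stored values.\<close>

lemma cell_bound:
  assumes "u < n" "v < n" "t \<le> L"
  shows "cell n L u v t < n * n * (L + 1)"
proof -
  have "(u * n + v) * (L + 1) + t < Suc (u * n + v) * (L + 1)" using assms(3) by simp
  also have "\<dots> \<le> n * n * (L + 1)"
    using index2_bound[OF assms(1,2)] by (intro mult_le_mono1) simp
  finally show ?thesis by (simp add: cell_def)
qed

text \<open>Two uses of \<open>row_major_inj\<close>, with row lengths \<open>L + 1\<close> and
  \<open>n\<close>.\<close>

lemma cell_inj:
  assumes "v < n" "v' < n" "t \<le> L" "t' \<le> L"
  shows "cell n L u v t = cell n L u' v' t' \<longleftrightarrow> u = u' \<and> v = v' \<and> t = t'"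
  unfolding cell_def
  using row_major_inj[of t "L + 1" t' "u * n + v" "u' * n + v'"] row_major_inj[OF assms(1,2)] assms(3,4)
  by auto

text \<open>The address determines \<open>u\<close>, \<open>v\<close> and \<open>t\<close>, so the
  existential quantifiers in \<open>label_array\<close> have a single candidate.\<close>

lemma label_array_cell:
  assumes "u < n" "v < n" "t \<in> {1..L}"
  shows "label_array n L G (cell n L u v t) \<noteq> 0 \<longleftrightarrow> {u, v} \<in> edges G \<and> t \<in> labels G {u, v}"
proof -
  have "(\<exists>u'<n. \<exists>v'<n. \<exists>t'\<in>{1..L}. cell n L u v t = cell n L u' v' t' \<and>
      {u', v'} \<in> edges G \<and> t' \<in> labels G {u', v'}) \<longleftrightarrow> {u, v} \<in> edges G \<and> t \<in> labels G {u, v}"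
    using assms cell_inj[of v n _ t L] by fastforce
  then show ?thesis unfolding label_array_def cell_def by simp
qed

text \<open>A frame condition, carried through the loop invariants so that the input and the results
  of earlier phases survive.\<close>

definition same :: "string set \<Rightarrow> store \<Rightarrow> store \<Rightarrow> bool" where
  "same X s s' \<longleftrightarrow> (\<forall>x. x \<notin> X \<longrightarrow> s' x = s x)"

lemma same_refl: "same X s s"
  by (simp add: same_def)

lemma same_trans: "same X s s' \<Longrightarrow> same Y s' s'' \<Longrightarrow> X \<subseteq> Z \<Longrightarrow> Y \<subseteq> Z \<Longrightarrow> same Z s s''"
  by (metis same_def subsetD)

lemma same_update [simp]: "x \<in> X \<Longrightarrow> same X s (s'(x := f)) \<longleftrightarrow> same X s s'"
  by (auto simp: same_def)

lemma same_assign [simp]: "x \<in> X \<Longrightarrow> same X s (assign x k s') \<longleftrightarrow> same X s s'"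
  by (auto simp: same_def)

section \<open>One round of the program\<close>

lemma find_arrival_runs:
  fixes s0 :: store
  assumes n: "s0 ''n'' 0 = n" and m: "matrix n (s0 ''m'') lab" and u: "s0 ''u'' 0 = u" "u < n"
    and c: "s0 ''c'' 0 = c" "c < n" and x: "s0 ''x'' 0 = u"
    and clique: "labelled_clique {..<n} L lab" and W: "n \<le> W"
  shows "runs W find_arrival s0 (2 + n * 4) (\<lambda>s. same {''x'', ''y''} s0 s \<and> s ''x'' 0 < n \<and>
    lab u (s ''x'' 0) \<le> lab (s ''x'' 0) c \<and> lab (s ''x'' 0) c = arrival {..<n} lab c u)"
proof -
  interpret labelled_clique "{..<n}" L lab by (fact clique)
  \<comment> \<open>The search starts at the admissible choice \<open>x = u\<close>. At
    \<open>j = n\<close> the minimality clause ranges over all vertices, and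
    \<open>arrival_eqI\<close> identifies the minimum.\<close>
  define I where "I = (\<lambda>j s. same {''x'', ''y''} s0 s \<and> s ''x'' 0 < n \<and>
    lab u (s ''x'' 0) \<le> lab (s ''x'' 0) c \<and> (\<forall>y<j. lab u y \<le> lab y c \<longrightarrow> lab (s ''x'' 0) c \<le> lab y c))"
  show ?thesis
    unfolding find_arrival_def
  proof (rule runs_For[where I = I and N = n and b = 2])
    show "I 0 (assign ''y'' 0 s0)" using u x by (simp add: I_def same_refl)
  next
    fix y s assume y: "y < n" "s ''y'' 0 = y" and I: "I y s"
    then have eqs: "s ''n'' = s0 ''n''" "s ''m'' = s0 ''m''" "s ''u'' = s0 ''u''" "s ''c'' = s0 ''c''"
      and sx: "s ''x'' 0 < n"
      by (simp_all add: I_def same_def)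
    show "runs W (Cond (Times (LE (Read ''m'' (index2 ''u'' ''y'')) (Read ''m'' (index2 ''y'' ''c'')))
           (LT (Read ''m'' (index2 ''y'' ''c'')) (Read ''m'' (index2 ''x'' ''c''))))
         (Write ''x'' (Const 0) (Var ''y'')) Skip) s 2
         (\<lambda>s'. s' ''y'' 0 = y \<and> I (Suc y) (assign ''y'' (Suc y) s'))"
      by (rule runs_Cond[where b = 1]; (rule runs_assign runs_Skip)?)
        (use y I W sx u c in \<open>auto simp: I_def eqs n matrixD[OF m] less_Suc_eq\<close>)
  next
    fix j s assume "I j s"
    then show "val (Var ''n'') s = n" using n by (simp add: I_def same_def)
  next
    fix s assume "I n s"
    then show "same {''x'', ''y''} s0 s \<and> s ''x'' 0 < n \<and>
      lab u (s ''x'' 0) \<le> lab (s ''x'' 0) c \<and> lab (s ''x'' 0) c = arrival {..<n} lab c u"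
      using arrival_eqI[of "s ''x'' 0" u c] by (auto simp: I_def)
  qed (use W in auto)
qed

text \<open>\<open>A\<close> is the set of pairs marked at the start of the round, \<open>D\<close>
  the set of those scanned so far, and \<open>S\<close> collects the scanned pairs that remain
  missed. The case of empty \<open>S\<close> is the state before the first missed pair is
  found.\<close>

definition scan_inv ::
  "nat \<Rightarrow> (nat \<Rightarrow> nat \<Rightarrow> nat) \<Rightarrow> nat \<Rightarrow> (nat \<times> nat) set \<Rightarrow> (nat \<times> nat) set \<Rightarrow> (nat \<Rightarrow> nat) \<Rightarrow> nat \<Rightarrow> nat \<Rightarrow> bool"
  where "scan_inv n lab c A D g b d \<longleftrightarrow>
    pairs n g = A \<union> {p \<in> D. \<not> missed {..<n} lab c p} \<and> d < n \<and>
    (let S = {p \<in> D. p \<notin> A \<and> missed {..<n} lab c p} in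
      S = {} \<and> b = 0 \<or> (\<exists>v. (d, v) \<in> S \<and> lab c v = b) \<and> (\<forall>(u', v')\<in>S. lab c v' \<le> b))"

lemma scan_inv_better:
  assumes "scan_inv n lab c A D g b d" "missed {..<n} lab c (u, v)" "(u, v) \<notin> pairs n g"
    "b \<le> lab c v" "u < n"
  shows "scan_inv n lab c A (insert (u, v) D) g (lab c v) u"
  using assms unfolding scan_inv_def Let_def by fastforce

text \<open>A label below \<open>b\<close> forces \<open>b\<close> to be positive, so
  \<open>S\<close> is nonempty and its recorded maximum stands.\<close>

lemma scan_inv_worse:
  assumes "scan_inv n lab c A D g b d" "missed {..<n} lab c (u, v)" "(u, v) \<notin> pairs n g"
    "lab c v < b"
  shows "scan_inv n lab c A (insert (u, v) D) g b d"
  using assms unfolding scan_inv_def Let_def by fastforce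

text \<open>A marked pair that has not been scanned belongs to \<open>A\<close>; hence
  \<open>S\<close> does not change, and marking the pair once more is harmless.\<close>

lemma scan_inv_good:
  assumes "scan_inv n lab c A D g b d" "\<not> missed {..<n} lab c (u, v) \<or> (u, v) \<in> pairs n g"
    "u < n" "v < n" "(u, v) \<notin> D"
  shows "scan_inv n lab c A (insert (u, v) D) (g(u * n + v := Suc 0)) b d"
proof -
  have "{p \<in> insert (u, v) D. p \<notin> A \<and> missed {..<n} lab c p} = {p \<in> D. p \<notin> A \<and> missed {..<n} lab c p}"
    using assms(1,2,5) by (auto simp: scan_inv_def)
  then show ?thesis
    using assms unfolding scan_inv_def pairs_update[OF assms(3,4)] Let_def by auto
qed

lemma scan_row_runs:
  fixes s0 :: store
  assumes n: "s0 ''n'' 0 = n" and m: "matrix n (s0 ''m'') lab" and u: "s0 ''u'' 0 = u" "u < n"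
    and c: "s0 ''c'' 0 = c" "c < n"
    and x: "s0 ''x'' 0 < n" "lab (s0 ''x'' 0) c = arrival {..<n} lab c u"
    and scan: "scan_inv n lab c A (before n u 0) (s0 ''g'') (s0 ''b'' 0) (s0 ''d'' 0)"
    and clique: "labelled_clique {..<n} L lab" and W: "n * n \<le> W" "L \<le> W"
  shows "runs W scan_row s0 (2 + n * 6) (\<lambda>s. same {''v'', ''b'', ''d'', ''g''} s0 s \<and>
    scan_inv n lab c A (before n (Suc u) 0) (s ''g'') (s ''b'' 0) (s ''d'' 0))"
proof -
  interpret labelled_clique "{..<n}" L lab by (fact clique)
  define I where "I = (\<lambda>j s. same {''v'', ''b'', ''d'', ''g''} s0 s \<and>
    scan_inv n lab c A (before n u j) (s ''g'') (s ''b'' 0) (s ''d'' 0))"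
  have "n \<le> W" by (rule order_trans[OF le_square W(1)])
  then have nW: "n \<le> W" "1 \<le> W" using u(2) by simp_all
  show ?thesis
    unfolding scan_row_def
  \<comment> \<open>The longest branch consists of two tests and two writes.\<close>
  proof (rule runs_For[where I = I and N = n and b = 4])
    show "I 0 (assign ''v'' 0 s0)" using scan by (simp add: I_def same_refl)
  next
    fix v s assume v: "v < n" "s ''v'' 0 = v" and I: "I v s"
    then have eqs: "s ''n'' = s0 ''n''" "s ''m'' = s0 ''m''" "s ''u'' = s0 ''u''" "s ''c'' = s0 ''c''"
      "s ''x'' = s0 ''x''" by (simp_all add: I_def same_def)
    have mis: "missed {..<n} lab c (u, v) \<longleftrightarrow> v \<noteq> c \<and> lab c v < lab (s0 ''x'' 0) c"
      using x by (simp add: missed_def)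
    have g: "(u, v) \<in> pairs n (s ''g'') \<longleftrightarrow> s ''g'' (u * n + v) \<noteq> 0"
      using u v by (simp add: pairs_def)
    \<comment> \<open>The label is stored in \<open>b\<close>, so it must fit into a word.\<close>
    have labW: "lab c v \<le> W" using lab_range[of c v] v c W by (cases "c = v") auto
    have new: "(u, v) \<notin> before n u v" by (simp add: before_def)
    note bSuc = before_Suc[OF u(2) v(1)]
    have scan_s: "scan_inv n lab c A (before n u v) (s ''g'') (s ''b'' 0) (s ''d'' 0)"
      using I by (simp add: I_def)
    show "runs W (Cond (Times (LT (Read ''g'' (index2 ''u'' ''v'')) (Const 1))
           (Times (NE (Var ''v'') (Var ''c''))
             (LT (Read ''m'' (index2 ''c'' ''v'')) (Read ''m'' (index2 ''x'' ''c'')))))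
         (Cond (LE (Var ''b'') (Read ''m'' (index2 ''c'' ''v'')))
           (Seq (Write ''b'' (Const 0) (Read ''m'' (index2 ''c'' ''v'')))
             (Write ''d'' (Const 0) (Var ''u'')))
           Skip)
         (Write ''g'' (index2 ''u'' ''v'') (Const 1))) s 4
         (\<lambda>s'. s' ''v'' 0 = v \<and> I (Suc v) (assign ''v'' (Suc v) s'))"
    proof (rule runs_Cond[where b = 3], goal_cases)
      case 1
      then have miss: "missed {..<n} lab c (u, v)" "(u, v) \<notin> pairs n (s ''g'')"
        using v u c x unfolding mis g by (auto simp: eqs n matrixD[OF m])
      show ?case
      proof (rule runs_Cond[where b = 2], goal_cases)
        case 1
        then have "s ''b'' 0 \<le> lab c v" using v c by (simp add: eqs n matrixD[OF m])
        from scan_inv_better[OF scan_s miss this u(2)]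
        have "scan_inv n lab c A (before n u (Suc v)) (s ''g'') (lab c v) u"
          using I by (simp add: I_def bSuc)
        then have "I (Suc v) (assign ''v'' (Suc v) (assign ''d'' u (assign ''b'' (lab c v) s)))"
          using I by (simp add: I_def)
        then show ?case
          by (intro runs_Seq[where a = 1 and a' = 1 and R = "\<lambda>s'. s' = assign ''b'' (lab c v) s"])
            (use u c v labW nW in \<open>auto intro!: runs_assign simp: eqs n matrixD[OF m]\<close>)
      next
        case 2
        then have "lab c v < s ''b'' 0" using v c by (simp add: eqs n matrixD[OF m])
        from scan_inv_worse[OF scan_s miss this] show ?case
          using I v by (intro runs_Skip) (auto simp: I_def bSuc)
      qed simp
    next
      case 2
      then have miss: "\<not> missed {..<n} lab c (u, v) \<or> (u, v) \<in> pairs n (s ''g'')"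
        using v u c x unfolding mis g by (auto simp: eqs n matrixD[OF m])
      from scan_inv_good[OF scan_s miss u(2) v(1) new]
      have "I (Suc v) (assign ''v'' (Suc v) (s(''g'' := (s ''g'')(u * n + v := Suc 0))))"
        using I by (simp add: I_def bSuc)
      then show ?case
        using index2_bound[OF u(2) v(1)] u v nW W by (intro runs_Write) (auto simp: eqs n)
    qed simp
  next
    fix j s assume "I j s"
    then show "val (Var ''n'') s = n" using n by (simp add: I_def same_def)
  next
    fix s assume "I n s"
    then show "same {''v'', ''b'', ''d'', ''g''} s0 s \<and>
      scan_inv n lab c A (before n (Suc u) 0) (s ''g'') (s ''b'' 0) (s ''d'' 0)"
      by (simp add: I_def before_row)
  qed (use nW in auto)
qed


text \<open>The clauses of \<open>step\<close> about the kept edges, restricted to the first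
  \<open>k\<close> vertices.\<close>

definition rows_kept ::
  "nat \<Rightarrow> (nat \<Rightarrow> nat \<Rightarrow> nat) \<Rightarrow> nat \<Rightarrow> (nat \<times> nat) set \<Rightarrow> nat \<Rightarrow> (nat \<times> nat) set \<Rightarrow> bool" where
  "rows_kept n lab c K k K' \<longleftrightarrow>
     K \<subseteq> K' \<and> K' \<subseteq> {..<n} \<times> {..<n} \<and> card K' \<le> card K + 2 * k \<and>
     (\<forall>u<k. (u, c) \<in> K' \<and>
       (\<exists>x<n. (u, x) \<in> K' \<and> lab u x \<le> lab x c \<and> lab x c = arrival {..<n} lab c u))"

lemma rows_kept_Suc:
  assumes "rows_kept n lab c K k K'" "k < n" "c < n" "x < n"
    "lab k x \<le> lab x c" "lab x c = arrival {..<n} lab c k"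
  shows "rows_kept n lab c K (Suc k) (insert (k, x) (insert (k, c) K'))"
proof -
  have "finite K'" using assms(1) finite_subset unfolding rows_kept_def by blast
  then have "card (insert (k, x) (insert (k, c) K')) \<le> Suc (Suc (card K'))"
    by (simp add: card_insert_if)
  then show ?thesis
    using assms unfolding rows_kept_def less_Suc_eq by fastforce
qed

abbreviation round_vars :: "string set" where
  "round_vars \<equiv> {''u'', ''x'', ''y'', ''v'', ''b'', ''d'', ''g'', ''h''}"

text \<open>The time is made up of three writes, \<open>2 + 4 * n\<close> steps of
  \<open>find_arrival\<close> and \<open>2 + 6 * n\<close> steps of \<open>scan_row\<close>.\<close>

lemma row_runs:
  fixes s0 :: store
  assumes n: "s0 ''n'' 0 = n" and m: "matrix n (s0 ''m'') lab" and u: "s0 ''u'' 0 = u" "u < n"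
    and c: "s0 ''c'' 0 = c" "c < n"
    and scan: "scan_inv n lab c A (before n u 0) (s0 ''g'') (s0 ''b'' 0) (s0 ''d'' 0)"
    and rows: "rows_kept n lab c K u (pairs n (s0 ''h''))"
    and clique: "labelled_clique {..<n} L lab" and W: "n * n \<le> W" "L \<le> W"
  shows "runs W (Seq (Write ''x'' (Const 0) (Var ''u''))
           (Seq find_arrival
           (Seq (Write ''h'' (index2 ''u'' ''c'') (Const 1))
           (Seq (Write ''h'' (index2 ''u'' ''x'') (Const 1))
             scan_row)))) s0 (7 + 10 * n) (\<lambda>s. same (round_vars - {''u''}) s0 s \<and>
    scan_inv n lab c A (before n (Suc u) 0) (s ''g'') (s ''b'' 0) (s ''d'' 0) \<and>
    rows_kept n lab c K (Suc u) (pairs n (s ''h'')))"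
proof -
  have "n \<le> W" by (rule order_trans[OF le_square W(1)])
  then have nW: "n \<le> W" "1 \<le> W" using u(2) by simp_all
  show ?thesis
  proof (rule runs_Seq[where a = 1 and a' = "6 + 10 * n" and R = "\<lambda>s. s = assign ''x'' u s0"])
    show "runs W (Write ''x'' (Const 0) (Var ''u'')) s0 1 (\<lambda>s. s = assign ''x'' u s0)"
      using u nW by (intro runs_assign) auto
  next
    fix s1 assume s1: "s1 = assign ''x'' u s0"
    show "runs W (Seq find_arrival (Seq (Write ''h'' (index2 ''u'' ''c'') (Const 1))
           (Seq (Write ''h'' (index2 ''u'' ''x'') (Const 1)) scan_row))) s1 (6 + 10 * n)
        (\<lambda>s. same (round_vars - {''u''}) s0 s \<and>
          scan_inv n lab c A (before n (Suc u) 0) (s ''g'') (s ''b'' 0) (s ''d'' 0) \<and>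
          rows_kept n lab c K (Suc u) (pairs n (s ''h'')))"
    proof (rule runs_Seq[OF find_arrival_runs[of s1 n lab u c L W], where a' = "4 + 6 * n"])
      fix s2 assume "same {''x'', ''y''} s1 s2 \<and> s2 ''x'' 0 < n \<and>
        lab u (s2 ''x'' 0) \<le> lab (s2 ''x'' 0) c \<and> lab (s2 ''x'' 0) c = arrival {..<n} lab c u"
      then have s2: "same {''x'', ''y''} s1 s2" and x: "s2 ''x'' 0 < n"
        "lab u (s2 ''x'' 0) \<le> lab (s2 ''x'' 0) c" "lab (s2 ''x'' 0) c = arrival {..<n} lab c u"
        by simp_all
      define x where "x = s2 ''x'' 0"
      note xs = x[folded x_def]
      have eqs: "s2 ''n'' = s0 ''n''" "s2 ''m'' = s0 ''m''" "s2 ''u'' = s0 ''u''" "s2 ''c'' = s0 ''c''"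
        "s2 ''g'' = s0 ''g''" "s2 ''b'' = s0 ''b''" "s2 ''d'' = s0 ''d''" "s2 ''h'' = s0 ''h''"
        using s2 by (simp_all add: s1 same_def)
      define s3 where "s3 = s2(''h'' := (s2 ''h'')(u * n + c := Suc 0))"
      define s4 where "s4 = s3(''h'' := (s3 ''h'')(u * n + x := Suc 0))"
      have W1: "runs W (Write ''h'' (index2 ''u'' ''c'') (Const 1)) s2 1 (\<lambda>s. s = s3)"
        using index2_bound[OF u(2) c(2)] W nW u c n
        by (intro runs_Write) (auto simp: s3_def eqs)
      have W2: "runs W (Write ''h'' (index2 ''u'' ''x'') (Const 1)) s3 1 (\<lambda>s. s = s4)"
        using index2_bound[OF u(2) xs(1)] W nW u n
        by (intro runs_Write) (auto simp: s4_def s3_def eqs x_def)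
      have h: "pairs n (s4 ''h'') = insert (u, x) (insert (u, c) (pairs n (s0 ''h'')))"
        by (simp add: s4_def s3_def eqs pairs_update[OF u(2) c(2)] pairs_update[OF u(2) xs(1)])
      have rows4: "rows_kept n lab c K (Suc u) (pairs n (s4 ''h''))"
        unfolding h using rows u(2) c(2) xs by (rule rows_kept_Suc)
      have same4: "same {''x'', ''y'', ''h''} s0 s4"
        using s2 by (auto simp: s4_def s3_def s1 same_def)
      have "runs W scan_row s4 (2 + n * 6) (\<lambda>s. same {''v'', ''b'', ''d'', ''g''} s4 s \<and>
          scan_inv n lab c A (before n (Suc u) 0) (s ''g'') (s ''b'' 0) (s ''d'' 0))"
        using n m u c x scan W
        by (intro scan_row_runs[OF _ _ _ _ _ _ _ _ _ clique]) (simp_all add: s4_def s3_def eqs)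
      then have scan4: "runs W scan_row s4 (2 + n * 6) (\<lambda>s. same (round_vars - {''u''}) s0 s \<and>
          scan_inv n lab c A (before n (Suc u) 0) (s ''g'') (s ''b'' 0) (s ''d'' 0) \<and>
          rows_kept n lab c K (Suc u) (pairs n (s ''h'')))"
      proof (rule runs_weaken)
        fix s assume s: "same {''v'', ''b'', ''d'', ''g''} s4 s \<and>
          scan_inv n lab c A (before n (Suc u) 0) (s ''g'') (s ''b'' 0) (s ''d'' 0)"
        have "same (round_vars - {''u''}) s0 s"
          by (rule same_trans[OF same4 conjunct1[OF s]]) auto
        moreover have "s ''h'' = s4 ''h''" using s by (simp add: same_def)
        ultimately show "same (round_vars - {''u''}) s0 s \<and>
          scan_inv n lab c A (before n (Suc u) 0) (s ''g'') (s ''b'' 0) (s ''d'' 0) \<and>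
          rows_kept n lab c K (Suc u) (pairs n (s ''h''))" using s rows4 by simp
      qed simp
      show "runs W (Seq (Write ''h'' (index2 ''u'' ''c'') (Const 1))
           (Seq (Write ''h'' (index2 ''u'' ''x'') (Const 1)) scan_row)) s2 (4 + 6 * n)
        (\<lambda>s. same (round_vars - {''u''}) s0 s \<and>
          scan_inv n lab c A (before n (Suc u) 0) (s ''g'') (s ''b'' 0) (s ''d'' 0) \<and>
          rows_kept n lab c K (Suc u) (pairs n (s ''h'')))"
        by (rule runs_Seq[OF W1, where a' = "3 + 6 * n"], hypsubst, rule runs_Seq[OF W2], hypsubst,
            rule scan4) auto
    qed (use n m u c clique nW in \<open>simp_all add: s1\<close>)
  qed simp
qed

text \<open>The program realises one abstract \<open>step\<close>, with the unmarked pairs as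
  \<open>B\<close>. The additive 5 accounts for three writes and the start and end of the
  loop.\<close>

lemma round_runs:
  fixes s0 :: store
  assumes n: "s0 ''n'' 0 = n" and m: "matrix n (s0 ''m'') lab" and c: "s0 ''c'' 0 = c" "c < n"
    and clique: "labelled_clique {..<n} L lab" and W: "n * n \<le> W" "L \<le> W"
  shows "runs W round_prog s0 (5 + n * (9 + 10 * n)) (\<lambda>s. same (insert ''c'' round_vars) s0 s \<and>
    step {..<n} lab (pairs n (s0 ''h'')) ({..<n} \<times> {..<n} - pairs n (s0 ''g'')) c
      (pairs n (s ''h'')) ({..<n} \<times> {..<n} - pairs n (s ''g'')) (s ''c'' 0))"
proof -
  let ?A = "pairs n (s0 ''g'')" and ?K = "pairs n (s0 ''h'')"
  define s1 where "s1 = assign ''b'' 0 s0"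
  define s2 where "s2 = assign ''d'' c s1"
  have "n \<le> W" by (rule order_trans[OF le_square W(1)])
  then have nW: "n \<le> W" "c \<le> W" using c(2) by simp_all
  have W1: "runs W (Write ''b'' (Const 0) (Const 0)) s0 1 (\<lambda>s. s = s1)"
    by (intro runs_assign) (auto simp: s1_def)
  have W2: "runs W (Write ''d'' (Const 0) (Var ''c'')) s1 1 (\<lambda>s. s = s2)"
    using nW c by (intro runs_assign) (auto simp: s2_def s1_def)
  define I where "I = (\<lambda>k s. same round_vars s0 s \<and>
    scan_inv n lab c ?A (before n k 0) (s ''g'') (s ''b'' 0) (s ''d'' 0) \<and>
    rows_kept n lab c ?K k (pairs n (s ''h'')))"
  have loop: "runs W (For ''u'' (Var ''n'')
           (Seq (Write ''x'' (Const 0) (Var ''u''))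
           (Seq find_arrival
           (Seq (Write ''h'' (index2 ''u'' ''c'') (Const 1))
           (Seq (Write ''h'' (index2 ''u'' ''x'') (Const 1))
             scan_row))))) s2 (2 + n * (9 + 10 * n)) (I n)"
  proof (rule runs_For[where I = I and N = n and b = "7 + 10 * n"])
    show "I 0 (assign ''u'' 0 s2)"
      using c by (auto simp: I_def s2_def s1_def same_refl scan_inv_def rows_kept_def pairs_def)
  next
    fix u s assume u: "u < n" "s ''u'' 0 = u" and I: "I u s"
    then have eqs: "s ''n'' = s0 ''n''" "s ''m'' = s0 ''m''" "s ''c'' = s0 ''c''"
      by (simp_all add: I_def same_def)
    show "runs W (Seq (Write ''x'' (Const 0) (Var ''u'')) (Seq find_arrival
        (Seq (Write ''h'' (index2 ''u'' ''c'') (Const 1))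
          (Seq (Write ''h'' (index2 ''u'' ''x'') (Const 1)) scan_row)))) s (7 + 10 * n)
        (\<lambda>s'. s' ''u'' 0 = u \<and> I (Suc u) (assign ''u'' (Suc u) s'))"
    proof (rule runs_weaken[OF row_runs[of s n lab u c ?A ?K L W]])
      fix s' assume s': "same (round_vars - {''u''}) s s' \<and>
        scan_inv n lab c ?A (before n (Suc u) 0) (s' ''g'') (s' ''b'' 0) (s' ''d'' 0) \<and>
        rows_kept n lab c ?K (Suc u) (pairs n (s' ''h''))"
      have "same round_vars s s'" using s' by (simp add: same_def)
      with I have "same round_vars s0 s'" by (auto simp: I_def same_def)
      moreover have "s' ''u'' = s ''u''" using s' by (simp add: same_def)
      ultimately show "s' ''u'' 0 = u \<and> I (Suc u) (assign ''u'' (Suc u) s')"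
        using s' u by (simp add: I_def)
    qed (use n m c I u clique W in \<open>simp_all add: eqs I_def\<close>)
  next
    fix k s assume "I k s"
    then show "val (Var ''n'') s = n" using n by (simp add: I_def same_def)
  qed (use nW in auto)
  have final: "runs W (Write ''c'' (Const 0) (Var ''d'')) s 1 (\<lambda>s. same (insert ''c'' round_vars) s0 s \<and>
      step {..<n} lab ?K ({..<n} \<times> {..<n} - ?A) c
        (pairs n (s ''h'')) ({..<n} \<times> {..<n} - pairs n (s ''g'')) (s ''c'' 0))"
    if I: "I n s" for s
  proof (rule runs_assign)
    let ?B = "{..<n} \<times> {..<n} - ?A" and ?B' = "{..<n} \<times> {..<n} - pairs n (s ''g'')"
    have scan: "scan_inv n lab c ?A ({..<n} \<times> {..<n}) (s ''g'') (s ''b'' 0) (s ''d'' 0)"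
      and rows: "rows_kept n lab c ?K n (pairs n (s ''h''))"
      using I by (simp_all add: I_def before_all)
    have B': "?B' = {p \<in> ?B. missed {..<n} lab c p}" and d: "s ''d'' 0 < n"
      using scan by (auto simp: scan_inv_def)
    have S: "{p \<in> {..<n} \<times> {..<n}. p \<notin> ?A \<and> missed {..<n} lab c p} = ?B'"
      unfolding B' by blast
    \<comment> \<open>After the whole square has been scanned, \<open>S\<close> is exactly the set
      of unmarked pairs, so \<open>d\<close> is the source of a best pair unless nothing is
      missed.\<close>
    have best: "?B' = {} \<or> best_pair lab ?B' c (s ''d'' 0)"
      using scan[unfolded scan_inv_def Let_def S, THEN conjunct2, THEN conjunct2]
    proof (elim disjE conjE exE)
      fix v assume "(s ''d'' 0, v) \<in> ?B'" "lab c v = s ''b'' 0" "\<forall>(u', v')\<in>?B'. lab c v' \<le> s ''b'' 0"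
      then have "best_pair lab ?B' c (s ''d'' 0)"
        unfolding best_pair_def by (intro exI[of _ v] conjI) simp_all
      then show ?thesis ..
    qed (rule disjI1)
    have "step {..<n} lab ?K ?B c (pairs n (s ''h'')) ?B' (s ''d'' 0)"
      unfolding step_def
      by (intro conjI B' best) (use rows d in \<open>simp_all add: rows_kept_def Bex_def\<close>)
    moreover have "same (insert ''c'' round_vars) s0 s" using I by (simp add: I_def same_def)
    ultimately show "same (insert ''c'' round_vars) s0 (assign ''c'' (val (Var ''d'') s) s) \<and>
      step {..<n} lab ?K ?B c (pairs n (assign ''c'' (val (Var ''d'') s) s ''h''))
        ({..<n} \<times> {..<n} - pairs n (assign ''c'' (val (Var ''d'') s) s ''g''))
        (assign ''c'' (val (Var ''d'') s) s ''c'' 0)" by simp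
    show "val (Var ''d'') s \<le> W" using d nW by simp
  qed simp
  show ?thesis
    unfolding round_prog_def
    by (rule runs_Seq[OF W1, where a' = "4 + n * (9 + 10 * n)"], hypsubst,
        rule runs_Seq[OF W2, where a' = "3 + n * (9 + 10 * n)"], hypsubst,
        rule runs_Seq[OF loop final]) auto
qed


section \<open>Computing the edge labels\<close>

text \<open>Invariant of the search in decreasing order: \<open>m\<close> is the least element of
  \<open>S\<close> above \<open>l\<close>, and 0 encodes that there is none.\<close>

definition least_above :: "nat set \<Rightarrow> nat \<Rightarrow> nat \<Rightarrow> bool" where
  "least_above S l m \<longleftrightarrow> m = 0 \<and> (\<forall>t\<in>S. t \<le> l) \<or> m \<in> S \<and> l < m \<and> (\<forall>t\<in>S. l < t \<longrightarrow> m \<le> t)"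

lemma least_above_hit: "Suc l \<in> S \<Longrightarrow> least_above S l (Suc l)"
  by (auto simp: least_above_def)

lemma least_above_miss:
  assumes "least_above S (Suc l) m" "Suc l \<notin> S"
  shows "least_above S l m"
proof -
  have "l < t \<longleftrightarrow> Suc l < t" "t \<le> l \<longleftrightarrow> t \<le> Suc l" if "t \<in> S" for t
    using that assms(2) by (metis Suc_lessI Suc_lessD, metis le_Suc_eq)
  with assms(1) show ?thesis unfolding least_above_def by auto
qed

text \<open>Labels are positive, so above 0 an edge has its least label; a non-edge leaves 0, which
  agrees with the default of \<open>first_label\<close>.\<close>

lemma least_above_edge_label:
  assumes "temporal_graph G" "least_above (if {u, v} \<in> edges G then labels G {u, v} else {}) 0 m"
  shows "m = edge_label G u v"
proof (cases "{u, v} \<in> edges G")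
  case True
  with assms obtain t where "t \<in> labels G {u, v}" "0 < t"
    by (fastforce simp: temporal_graph_def)
  with assms True have "m \<in> labels G {u, v}" "\<forall>t\<in>labels G {u, v}. m \<le> t"
    by (auto simp: least_above_def temporal_graph_def)
  then have "(LEAST t. t \<in> labels G {u, v}) = m" by (intro Least_equality) auto
  with True show ?thesis by (simp add: edge_label_def first_label_def)
next
  case False
  with assms(2) show ?thesis by (simp add: least_above_def edge_label_def first_label_def)
qed

lemma find_label_runs:
  fixes s0 :: store
  assumes n: "s0 ''n'' 0 = n" and L: "s0 ''L'' 0 = L" and inp: "s0 ''in'' = label_array n L G"
    and u: "s0 ''u'' 0 = u" "u < n" and v: "s0 ''v'' 0 = v" "v < n"
    and G: "temporal_graph G" "has_lifetime G L" and W: "n * n \<le> W" "L \<le> W"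
  shows "runs W (Seq (Write ''m'' (index2 ''u'' ''v'') (Const 0)) (For ''t'' (Var ''L'')
       (Cond (Read ''in'' (index3 ''u'' ''v'' (Minus (Var ''L'') (Var ''t''))))
         (Write ''m'' (index2 ''u'' ''v'') (Minus (Var ''L'') (Var ''t''))) Skip))) s0 (3 + L * 4)
     (\<lambda>s. same {''t'', ''m''} s0 s \<and> s ''m'' = (s0 ''m'')(u * n + v := edge_label G u v))"
proof -
  let ?S = "if {u, v} \<in> edges G then labels G {u, v} else {}"
  define s1 where "s1 = s0(''m'' := (s0 ''m'')(u * n + v := 0))"
  have idx: "u * n + v \<le> W" using index2_bound[OF u(2) v(2)] W by simp
  define I where "I = (\<lambda>k s. same {''t'', ''m''} s0 s \<and>
    (\<exists>m. s ''m'' = (s0 ''m'')(u * n + v := m) \<and> least_above ?S (L - k) m))"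
  have "runs W (Write ''m'' (index2 ''u'' ''v'') (Const 0)) s0 1 (\<lambda>s. s = s1)"
    using idx u v n by (intro runs_Write) (auto simp: s1_def)
  moreover have "runs W (For ''t'' (Var ''L'')
       (Cond (Read ''in'' (index3 ''u'' ''v'' (Minus (Var ''L'') (Var ''t''))))
         (Write ''m'' (index2 ''u'' ''v'') (Minus (Var ''L'') (Var ''t''))) Skip)) s1 (2 + L * 4)
     (\<lambda>s. same {''t'', ''m''} s0 s \<and> s ''m'' = (s0 ''m'')(u * n + v := edge_label G u v))"
  proof (rule runs_For[where I = I and N = L and b = 2])
    \<comment> \<open>By the lifetime bound no label exceeds \<open>L\<close>, so the initial 0 is
      correct.\<close>
    have "least_above ?S L 0" using G(2) by (fastforce simp: least_above_def has_lifetime_def)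
    then show "I 0 (assign ''t'' 0 s1)" by (auto simp: I_def s1_def same_refl)
  next
    fix k s assume k: "k < L" "s ''t'' 0 = k" and I: "I k s"
    then have eqs: "s ''n'' = s0 ''n''" "s ''L'' = s0 ''L''" "s ''u'' = s0 ''u''" "s ''v'' = s0 ''v''"
      "s ''in'' = s0 ''in''" by (simp_all add: I_def same_def)
    define l where "l = L - Suc k"
    have l: "L - k = Suc l" using k(1) by (simp add: l_def)
    then have "Suc l \<in> {1..L}" by auto
    note hit = label_array_cell[OF u(2) v(2) this, of G]
    show "runs W (Cond (Read ''in'' (index3 ''u'' ''v'' (Minus (Var ''L'') (Var ''t''))))
         (Write ''m'' (index2 ''u'' ''v'') (Minus (Var ''L'') (Var ''t''))) Skip) s 2
         (\<lambda>s'. s' ''t'' 0 = k \<and> I (Suc k) (assign ''t'' (Suc k) s'))"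
    proof (rule runs_Cond[where b = 1], goal_cases)
      case 1
      then have "Suc l \<in> ?S" using hit u v n L k inp by (simp add: eqs l)
      then have "least_above ?S (L - Suc k) (Suc l)"
        unfolding l_def[symmetric] by (rule least_above_hit)
      then show ?case
        using I k u v n L idx W l by (intro runs_Write) (auto simp: I_def eqs)
    next
      case 2
      then have "Suc l \<notin> ?S" using hit u v n L k inp by (simp add: eqs l)
      with I have "I (Suc k) (assign ''t'' (Suc k) s)"
        unfolding I_def l l_def[symmetric] using least_above_miss[of ?S l] by auto
      then show ?case using k by (intro runs_Skip) auto
    qed simp
  next
    fix k s assume "I k s"
    then show "val (Var ''L'') s = L" using L by (simp add: I_def same_def)
  next
    fix s assume "I L s"
    then show "same {''t'', ''m''} s0 s \<and> s ''m'' = (s0 ''m'')(u * n + v := edge_label G u v)"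
      using least_above_edge_label[OF G(1)] by (auto simp: I_def)
  qed (use W in auto)
  ultimately show ?thesis by (auto intro: runs_Seq)
qed

lemma find_labels_runs:
  fixes s0 :: store
  assumes n: "s0 ''n'' 0 = n" and L: "s0 ''L'' 0 = L" and inp: "s0 ''in'' = label_array n L G"
    and G: "temporal_graph G" "has_lifetime G L" and W: "n * n \<le> W" "L \<le> W"
  shows "runs W find_labels s0 (2 + n * (4 + n * (5 + L * 4)))
    (\<lambda>s. same {''u'', ''v'', ''t'', ''m''} s0 s \<and> matrix n (s ''m'') (edge_label G))"
proof -
  have nW: "n \<le> W" by (rule order_trans[OF le_square W(1)])
  define J where "J = (\<lambda>k j s. same {''u'', ''v'', ''t'', ''m''} s0 s \<and>
    (\<forall>(a, b)\<in>before n k j. s ''m'' (a * n + b) = edge_label G a b))"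
  show ?thesis
    unfolding find_labels_def
  proof (rule runs_For[where I = "\<lambda>k. J k 0" and N = n and b = "2 + n * (5 + L * 4)"])
    show "J 0 0 (assign ''u'' 0 s0)" by (simp add: J_def same_refl)
  next
    fix u s assume u: "u < n" "s ''u'' 0 = u" and J: "J u 0 s"
    show "runs W (For ''v'' (Var ''n'') (Seq (Write ''m'' (index2 ''u'' ''v'') (Const 0)) (For ''t'' (Var ''L'')
       (Cond (Read ''in'' (index3 ''u'' ''v'' (Minus (Var ''L'') (Var ''t''))))
         (Write ''m'' (index2 ''u'' ''v'') (Minus (Var ''L'') (Var ''t''))) Skip)))) s
         (2 + n * (5 + L * 4)) (\<lambda>s'. s' ''u'' 0 = u \<and> J (Suc u) 0 (assign ''u'' (Suc u) s'))"
    proof (rule runs_For[where I = "\<lambda>j s. s ''u'' 0 = u \<and> J u j s" and N = n and b = "3 + L * 4"])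
      show "assign ''v'' 0 s ''u'' 0 = u \<and> J u 0 (assign ''v'' 0 s)" using J u by (simp add: J_def)
    next
      fix v s assume v: "v < n" "s ''v'' 0 = v" and J': "s ''u'' 0 = u \<and> J u v s"
      then have eqs: "s ''n'' = s0 ''n''" "s ''L'' = s0 ''L''" "s ''in'' = s0 ''in''"
        by (simp_all add: J_def same_def)
      show "runs W (Seq (Write ''m'' (index2 ''u'' ''v'') (Const 0)) (For ''t'' (Var ''L'')
         (Cond (Read ''in'' (index3 ''u'' ''v'' (Minus (Var ''L'') (Var ''t''))))
           (Write ''m'' (index2 ''u'' ''v'') (Minus (Var ''L'') (Var ''t''))) Skip))) s (3 + L * 4)
         (\<lambda>s'. s' ''v'' 0 = v \<and> assign ''v'' (Suc v) s' ''u'' 0 = u \<and> J u (Suc v) (assign ''v'' (Suc v) s'))"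
      proof (rule runs_weaken[OF find_label_runs[of s n L G u v W]])
        fix s' assume s': "same {''t'', ''m''} s s' \<and> s' ''m'' = (s ''m'')(u * n + v := edge_label G u v)"
        have "same {''u'', ''v'', ''t'', ''m''} s0 s'"
          using s' J' by (auto simp: J_def same_def)
        moreover have "s' ''u'' = s ''u''" "s' ''v'' = s ''v''" using s' by (simp_all add: same_def)
        \<comment> \<open>The new entry does not overwrite an earlier one.\<close>
        moreover have "a * n + b \<noteq> u * n + v" if "(a, b) \<in> before n u v" for a b
          using that v row_major_inj[of b n v] by (auto simp: before_def)
        then have "\<forall>(a, b)\<in>before n u (Suc v). s' ''m'' (a * n + b) = edge_label G a b"
          using J' s' u v unfolding before_Suc[OF u(1) v(1)] J_def by auto
        ultimately show "s' ''v'' 0 = v \<and> assign ''v'' (Suc v) s' ''u'' 0 = u \<and>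
            J u (Suc v) (assign ''v'' (Suc v) s')"
          using J' v by (simp add: J_def)
      qed (use n L inp u v J' G W in \<open>simp_all add: eqs\<close>)
    next
      fix j s assume "s ''u'' 0 = u \<and> J u j s"
      then show "val (Var ''n'') s = n" using n by (simp add: J_def same_def)
    next
      fix s assume "s ''u'' 0 = u \<and> J u n s"
      then show "s ''u'' 0 = u \<and> J (Suc u) 0 (assign ''u'' (Suc u) s)"
        by (simp add: J_def before_row)
    qed (use nW in auto)
  next
    fix k s assume "J k 0 s"
    then show "val (Var ''n'') s = n" using n by (simp add: J_def same_def)
  next
    fix s assume "J n 0 s"
    then show "same {''u'', ''v'', ''t'', ''m''} s0 s \<and> matrix n (s ''m'') (edge_label G)"
      by (auto simp: J_def before_all matrix_def)
  qed (use nW in \<open>auto simp: algebra_simps\<close>)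
qed

section \<open>Writing the output\<close>

text \<open>The partial output after the pairs in \<open>D\<close> have been handled; on the full
  square it is the encoding of \<open>kept_graph\<close>.\<close>

definition kept_array ::
  "nat \<Rightarrow> nat \<Rightarrow> (nat \<Rightarrow> nat \<Rightarrow> nat) \<Rightarrow> (nat \<times> nat) set \<Rightarrow> (nat \<times> nat) set \<Rightarrow> nat \<Rightarrow> nat" where
  "kept_array n L lab K D i =
     (if \<exists>(u, v)\<in>D. i = cell n L u v (lab u v) \<and> lab u v \<noteq> 0 \<and> ((u, v) \<in> K \<or> (v, u) \<in> K)
      then 1 else 0)"

lemma kept_array_empty: "kept_array n L lab K {} = (\<lambda>_. 0)"
  by (rule ext) (simp add: kept_array_def)

lemma kept_array_insert:
  "kept_array n L lab K (insert (u, v) D) =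
     (if lab u v \<noteq> 0 \<and> ((u, v) \<in> K \<or> (v, u) \<in> K)
      then (kept_array n L lab K D)(cell n L u v (lab u v) := Suc 0) else kept_array n L lab K D)"
proof
  fix i
  show "kept_array n L lab K (insert (u, v) D) i = (if lab u v \<noteq> 0 \<and> ((u, v) \<in> K \<or> (v, u) \<in> K)
      then (kept_array n L lab K D)(cell n L u v (lab u v) := Suc 0) else kept_array n L lab K D) i"
    by (cases "i = cell n L u v (lab u v)") (simp_all add: kept_array_def)
qed

text \<open>A kept edge carries a single label, which fixes the time index, and off the diagonal
  this label is nonzero.\<close>

lemma kept_array_label_array:
  assumes G: "temporal_clique G" "verts G = {..<n}" "has_lifetime G L"
  shows "kept_array n L (edge_label G) K ({..<n} \<times> {..<n}) = label_array n L (kept_graph G K)"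
proof -
  interpret labelled_clique "{..<n}" L "edge_label G"
    using labelled_clique_edge_label[OF G(1,3)] G(2) by simp
  have lab: "edge_label G u v \<in> {1..L}" if "u < n" "v < n" "u \<noteq> v" for u v
    using lab_range that by simp
  have lb: "t \<in> labels (kept_graph G K) {u, v} \<longleftrightarrow> t = edge_label G u v" for u v t
    by (simp add: kept_graph_def edge_label_def)
  have "(\<exists>(u, v)\<in>{..<n} \<times> {..<n}. i = cell n L u v (edge_label G u v) \<and> edge_label G u v \<noteq> 0 \<and>
      ((u, v) \<in> K \<or> (v, u) \<in> K)) \<longleftrightarrow>
    (\<exists>u<n. \<exists>v<n. \<exists>t\<in>{1..L}. i = cell n L u v t \<and>
      {u, v} \<in> edges (kept_graph G K) \<and> t \<in> labels (kept_graph G K) {u, v})" (is "?l \<longleftrightarrow> ?r") for i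
  proof
    assume ?l
    then obtain u v where uv: "u < n" "v < n" "i = cell n L u v (edge_label G u v)"
      "edge_label G u v \<noteq> 0" "(u, v) \<in> K \<or> (v, u) \<in> K" by auto
    then have "u \<noteq> v" by auto
    with uv lab[OF uv(1,2)] show ?r
      unfolding kept_graph_edge lb adj_def by blast
  next
    assume ?r
    then obtain u v where uv: "u < n" "v < n" "i = cell n L u v (edge_label G u v)"
      "u \<noteq> v" "(u, v) \<in> K \<or> (v, u) \<in> K" unfolding kept_graph_edge lb adj_def by blast
    then have "edge_label G u v \<noteq> 0" using lab[of u v] by auto
    with uv show ?l by blast
  qed
  then show ?thesis unfolding kept_array_def label_array_def cell_def by (simp only:)
qed

lemma output_runs:
  fixes s0 :: store
  assumes n: "s0 ''n'' 0 = n" and L: "s0 ''L'' 0 = L" and out: "s0 ''out'' = (\<lambda>_. 0)"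
    and m: "matrix n (s0 ''m'') (edge_label G)"
    and G: "temporal_clique G" "verts G = {..<n}" "has_lifetime G L" and W: "n * n * (L + 1) \<le> W"
  shows "runs W output_prog s0 (2 + n * (4 + n * 4))
    (\<lambda>s. s ''out'' = label_array n L (kept_graph G (pairs n (s0 ''h''))))"
proof -
  interpret labelled_clique "{..<n}" L "edge_label G"
    using labelled_clique_edge_label[OF G(1,3)] G(2) by simp
  have "n * n * 1 \<le> n * n * (L + 1)" by (intro mult_le_mono2) simp
  then have "n * n \<le> W" using W by simp
  then have nW: "n \<le> W" by (rule order_trans[OF le_square])
  define J where "J = (\<lambda>k j s. same {''u'', ''v'', ''out''} s0 s \<and>
    s ''out'' = kept_array n L (edge_label G) (pairs n (s0 ''h'')) (before n k j))"
  show ?thesis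
    unfolding output_prog_def
  proof (rule runs_For[where I = "\<lambda>k. J k 0" and N = n and b = "2 + n * 4"])
    show "J 0 0 (assign ''u'' 0 s0)" by (simp add: J_def same_refl kept_array_empty out)
  next
    fix u s assume u: "u < n" "s ''u'' 0 = u" and J: "J u 0 s"
    show "runs W (For ''v'' (Var ''n'') (Cond (Times (Read ''m'' (index2 ''u'' ''v''))
           (Plus (Read ''h'' (index2 ''u'' ''v'')) (Read ''h'' (index2 ''v'' ''u''))))
         (Write ''out'' (index3 ''u'' ''v'' (Read ''m'' (index2 ''u'' ''v''))) (Const 1)) Skip)) s
         (2 + n * 4) (\<lambda>s'. s' ''u'' 0 = u \<and> J (Suc u) 0 (assign ''u'' (Suc u) s'))"
    proof (rule runs_For[where I = "\<lambda>j s. s ''u'' 0 = u \<and> J u j s" and N = n and b = 2])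
      show "assign ''v'' 0 s ''u'' 0 = u \<and> J u 0 (assign ''v'' 0 s)" using J u by (simp add: J_def)
    next
      fix v s assume v: "v < n" "s ''v'' 0 = v" and J': "s ''u'' 0 = u \<and> J u v s"
      then have eqs: "s ''n'' = s0 ''n''" "s ''L'' = s0 ''L''" "s ''m'' = s0 ''m''" "s ''h'' = s0 ''h''"
        by (simp_all add: J_def same_def)
      \<comment> \<open>The label is part of the output address, whence the word bound
        \<open>n * n * (L + 1)\<close>.\<close>
      have "edge_label G u v \<le> L" using lab_range[of u v] u v by (cases "u = v") auto
      from cell_bound[OF u(1) v(1) this] W
      have idx: "cell n L u v (edge_label G u v) < W" by simp
      have h: "(a, b) \<in> pairs n (s0 ''h'') \<longleftrightarrow> s0 ''h'' (a * n + b) \<noteq> 0" if "a < n" "b < n" for a b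
        using that by (simp add: pairs_def)
      show "runs W (Cond (Times (Read ''m'' (index2 ''u'' ''v''))
           (Plus (Read ''h'' (index2 ''u'' ''v'')) (Read ''h'' (index2 ''v'' ''u''))))
         (Write ''out'' (index3 ''u'' ''v'' (Read ''m'' (index2 ''u'' ''v''))) (Const 1)) Skip) s 2
         (\<lambda>s'. s' ''v'' 0 = v \<and> assign ''v'' (Suc v) s' ''u'' 0 = u \<and> J u (Suc v) (assign ''v'' (Suc v) s'))"
        by (rule runs_Cond[where b = 1]; (rule runs_Write runs_Skip)?)
          (use u v J' idx h[OF u(1) v(1)] h[OF v(1) u(1)] in
            \<open>auto simp: J_def eqs n L matrixD[OF m] before_Suc kept_array_insert\<close>)
    next
      fix j s assume "s ''u'' 0 = u \<and> J u j s"
      then show "val (Var ''n'') s = n" using n by (simp add: J_def same_def)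
    next
      fix s assume "s ''u'' 0 = u \<and> J u n s"
      then show "s ''u'' 0 = u \<and> J (Suc u) 0 (assign ''u'' (Suc u) s)"
        by (simp add: J_def before_row)
    qed (use nW in auto)
  next
    fix k s assume "J k 0 s"
    then show "val (Var ''n'') s = n" using n by (simp add: J_def same_def)
  next
    fix s assume "J n 0 s"
    then show "s ''out'' = label_array n L (kept_graph G (pairs n (s0 ''h'')))"
      using kept_array_label_array[OF G] by (simp add: J_def before_all)
  qed (use nW in \<open>auto simp: algebra_simps\<close>)
qed

section \<open>Correctness and running time of the whole program\<close>

lemma spanner_prog_runs:
  assumes G: "temporal_clique G" "verts G = {..<n}" "has_lifetime G L" and pos: "1 \<le> n" "1 \<le> L"
  shows "runs ((n + L) ^ 3) spanner_prog (input_store n L G) (60 * n ^ 3 * L)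
    (\<lambda>s. \<exists>H. s ''out'' = label_array n L H \<and> temporal_spanner 3 G H \<and> tg_size H \<le> 2 * n * L)"
proof -
  define W where "W = (n + L) ^ 3"
  let ?l = "edge_label G" and ?s0 = "input_store n L G"
  let ?X = "insert ''i'' (insert ''c'' round_vars)"
  interpret labelled_clique "{..<n}" L ?l
    using labelled_clique_edge_label[OF G(1,3)] G(2) by simp
  have tg: "temporal_graph G" using G by (simp add: temporal_clique_def)
  \<comment> \<open>Each of the three factors is at most \<open>n + L\<close>, the last one because
    \<open>n \<ge> 1\<close>.\<close>
  have W3: "n * n * (L + 1) \<le> W"
    unfolding W_def power3_eq_cube using pos by (intro mult_le_mono) auto
  have "n * n * 1 \<le> n * n * (L + 1)" "1 * 1 * L \<le> n * n * (L + 1)"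
    using pos by (intro mult_le_mono; simp)+
  then have W: "n * n \<le> W" "L \<le> W" using W3 by simp_all
  have st: "?s0 ''n'' 0 = n" "?s0 ''L'' 0 = L" "?s0 ''in'' = label_array n L G"
    by (simp_all add: input_store_def)
  have rounds: "runs W (Seq (For ''i'' (Var ''L'') round_prog) output_prog) s1
      ((2 + L * (7 + n * (9 + 10 * n))) + (2 + n * (4 + n * 4)))
      (\<lambda>s. \<exists>H. s ''out'' = label_array n L H \<and> temporal_spanner 3 G H \<and> tg_size H \<le> 2 * n * L)"
    if s1: "same {''u'', ''v'', ''t'', ''m''} ?s0 s1 \<and> matrix n (s1 ''m'') ?l" for s1
  proof -
    \<comment> \<open>Untouched arrays are zero: no edge is kept, no pair is marked, and the first
      centre is vertex 0, which exists as \<open>n \<ge> 1\<close>.\<close>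
    have st1: "s1 ''n'' 0 = n" "s1 ''L'' 0 = L" "s1 ''g'' = (\<lambda>_. 0)" "s1 ''h'' = (\<lambda>_. 0)"
      "s1 ''c'' 0 = 0" "s1 ''out'' = (\<lambda>_. 0)" using s1 by (simp_all add: same_def input_store_def)
    define I where "I = (\<lambda>i s. same ?X s1 s \<and>
      rounds_inv {..<n} ?l i (pairs n (s ''h'')) ({..<n} \<times> {..<n} - pairs n (s ''g'')) (s ''c'' 0))"
    show ?thesis
    proof (rule runs_Seq[where R = "I L"])
      show "runs W (For ''i'' (Var ''L'') round_prog) s1 (2 + L * (7 + n * (9 + 10 * n))) (I L)"
      proof (rule runs_For[where I = I and N = L and b = "5 + n * (9 + 10 * n)"])
        show "I 0 (assign ''i'' 0 s1)"
          using rounds_inv_init[of 0] pos by (simp add: I_def same_refl st1 pairs_def)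
      next
        fix i s assume i: "i < L" "s ''i'' 0 = i" and I: "I i s"
        then have eqs: "s ''n'' = s1 ''n''" "s ''m'' = s1 ''m''" by (simp_all add: I_def same_def)
        have c: "s ''c'' 0 < n" using I by (simp add: I_def rounds_inv_def)
        show "runs W round_prog s (5 + n * (9 + 10 * n))
            (\<lambda>s'. s' ''i'' 0 = i \<and> I (Suc i) (assign ''i'' (Suc i) s'))"
        proof (rule runs_weaken[OF round_runs[of s n ?l "s ''c'' 0" L W]])
          fix s' assume s': "same (insert ''c'' round_vars) s s' \<and>
            step {..<n} ?l (pairs n (s ''h'')) ({..<n} \<times> {..<n} - pairs n (s ''g'')) (s ''c'' 0)
              (pairs n (s' ''h'')) ({..<n} \<times> {..<n} - pairs n (s' ''g'')) (s' ''c'' 0)"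
          have "same ?X s1 s'" using I s' by (auto simp: I_def same_def)
          moreover have "s' ''i'' = s ''i''" using s' by (simp add: same_def)
          moreover have "rounds_inv {..<n} ?l (Suc i) (pairs n (s' ''h''))
              ({..<n} \<times> {..<n} - pairs n (s' ''g'')) (s' ''c'' 0)"
            using I s' step_inv unfolding I_def by blast
          ultimately show "s' ''i'' 0 = i \<and> I (Suc i) (assign ''i'' (Suc i) s')"
            using i by (simp add: I_def)
        qed (use st1 s1 c W labelled_clique_axioms in \<open>simp_all add: eqs\<close>)
      next
        fix i s assume "I i s"
        then show "val (Var ''L'') s = L" using st1 by (simp add: I_def same_def)
      qed (use W in auto)
    next
      fix s assume I: "I L s"
      then have eqs: "s ''n'' = s1 ''n''" "s ''L'' = s1 ''L''" "s ''m'' = s1 ''m''" "s ''out'' = s1 ''out''"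
        by (simp_all add: I_def same_def)
      let ?H = "kept_graph G (pairs n (s ''h''))"
      have "rounds_inv (verts G) ?l L (pairs n (s ''h'')) ({..<n} \<times> {..<n} - pairs n (s ''g'')) (s ''c'' 0)"
        using I by (simp add: I_def G(2))
      from rounds_spanner[OF G(1,3) pos(2) this]
      have H: "temporal_spanner 3 G ?H" "tg_size ?H \<le> 2 * n * L" by (simp_all add: G(2))
      show "runs W output_prog s (2 + n * (4 + n * 4))
          (\<lambda>s. \<exists>H. s ''out'' = label_array n L H \<and> temporal_spanner 3 G H \<and> tg_size H \<le> 2 * n * L)"
        by (rule runs_weaken[OF output_runs[of s n L G W]])
          (use st1 s1 G W3 H in \<open>auto simp: eqs\<close>)
    qed simp
  qed
  have time: "(2 + n * (4 + n * (5 + L * 4))) + ((2 + L * (7 + n * (9 + 10 * n))) + (2 + n * (4 + n * 4)))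
      \<le> 60 * n ^ 3 * L"
  proof -
    let ?b = "n * n * n * L"
    \<comment> \<open>As \<open>n\<close> and \<open>L\<close> are positive, every monomial of the
      time bound is at most \<open>?b\<close>; their coefficients add up to 53.\<close>
    have "1 * 1 * 1 * 1 \<le> ?b" "n * 1 * 1 * 1 \<le> ?b" "n * n * 1 * 1 \<le> ?b" "1 * 1 * 1 * L \<le> ?b"
      "n * 1 * 1 * L \<le> ?b" "n * n * 1 * L \<le> ?b"
      by (intro mult_le_mono order_refl pos)+
    then have "1 \<le> ?b" "n \<le> ?b" "n * n \<le> ?b" "L \<le> ?b" "n * L \<le> ?b" "n * n * L \<le> ?b"
      by (simp_all only: mult_1 mult_1_right)
    then have "6 + 8 * n + 9 * (n * n) + 7 * L + 9 * (n * L) + 14 * (n * n * L) \<le> 60 * ?b"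
      by linarith
    then show ?thesis by (simp add: power3_eq_cube algebra_simps)
  qed
  show ?thesis
    unfolding spanner_prog_def W_def[symmetric]
    by (rule runs_Seq[OF find_labels_runs[OF st tg G(3) W] rounds time])
qed

theorem theorem2:
  "(\<exists>c::nat. \<forall>n\<ge>1. \<forall>L\<ge>1. \<forall>G::'a tgraph.
      temporal_clique G \<and> card (verts G) = n \<and> has_lifetime G L \<longrightarrow>
      (\<exists>H. temporal_spanner 3 G H \<and> tg_size H \<le> c * n * L)) \<and>
   (\<exists>(P::prog) (c::nat) (k::nat). \<forall>n\<ge>1. \<forall>L\<ge>1. \<forall>G::nat tgraph.
      temporal_clique G \<and> verts G = {..<n} \<and> has_lifetime G L \<longrightarrow>
      (\<exists>T s H. exec ((n + L) ^ k) P (input_store n L G) T s \<and>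
         T \<le> c * n ^ 3 * L \<and>
         s ''out'' = label_array n L H \<and>
         temporal_spanner 3 G H \<and> tg_size H \<le> c * n * L))"
proof (rule conjI)
  show "\<exists>c::nat. \<forall>n\<ge>1. \<forall>L\<ge>1. \<forall>G::'a tgraph.
      temporal_clique G \<and> card (verts G) = n \<and> has_lifetime G L \<longrightarrow>
      (\<exists>H. temporal_spanner 3 G H \<and> tg_size H \<le> c * n * L)"
  proof (rule exI[of _ 2], intro allI impI, elim conjE)
    fix n L :: nat and G :: "'a tgraph"
    assume "1 \<le> n" "1 \<le> L" "temporal_clique G" "card (verts G) = n" "has_lifetime G L"
    then show "\<exists>H. temporal_spanner 3 G H \<and> tg_size H \<le> 2 * n * L"
      using small_spanner_exists[of G L] by simp
  qed
next
  have *: "\<exists>T s H. exec ((n + L) ^ 3) spanner_prog (input_store n L G) T s \<and> T \<le> 60 * n ^ 3 * L \<and>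
      s ''out'' = label_array n L H \<and> temporal_spanner 3 G H \<and> tg_size H \<le> 60 * n * L"
    if G: "temporal_clique G" "verts G = {..<n}" "has_lifetime G L" "1 \<le> n" "1 \<le> L" for n L G
  proof -
    \<comment> \<open>One constant has to serve for both time and size.\<close>
    have "2 * n * L \<le> 60 * n * L" by (intro mult_le_mono) auto
    then show ?thesis
      using spanner_prog_runs[OF G] unfolding runs_def by (meson le_trans)
  qed
  show "\<exists>(P::prog) (c::nat) (k::nat). \<forall>n\<ge>1. \<forall>L\<ge>1. \<forall>G::nat tgraph.
      temporal_clique G \<and> verts G = {..<n} \<and> has_lifetime G L \<longrightarrow>
      (\<exists>T s H. exec ((n + L) ^ k) P (input_store n L G) T s \<and>
         T \<le> c * n ^ 3 * L \<and>
         s ''out'' = label_array n L H \<and>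
         temporal_spanner 3 G H \<and> tg_size H \<le> c * n * L)"
    by (rule exI[of _ spanner_prog], rule exI[of _ 60], rule exI[of _ 3], intro allI impI,
        elim conjE, rule *)
qed

end
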